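(* Let $S\in\mathbb{C}^{n\times n}$ be a singular matrix with $\lambda(S)\subseteq\mathbb{C}^+\cup\{0\}$ whose zero eigenvalue is semisimple. Let $\gamma>0$, let $r>1$ be an integer, and let $\{Q_k\}_{k\ge1}$ and $\{\widehat{Q}_k\}_{k\ge1}$ be, respectively, the basic and the order-$r$ square root iterations described in the context. Then: 1. $Q_k\to\sqrt{S}$ sublinearly; 2. $\widehat{Q}_k\to\sqrt{S}$ q-linearly with q-factor $\frac1r$.
   Context: $\mathbb{C}^+$ is the open right half plane and $\lambda(S)$ the set of eigenvalues of $S$. $\sqrt{S}$ is the unique matrix $X$ with $X^2=S$, $\lambda(X)\subset\mathbb{C}^+\cup\{0\}$ and with $0$ a semisimple eigenvalue of $X$. Basic iteration: $Q_1=\gamma I_n$ and $Q_{k+1}=(\gamma Q_k+S)(\gamma I_n+Q_k)^{-1}$ for $k\ge1$. Order-$r$ iteration (stopping criteria ignored): $\widehat{Q}_1=\gamma I_n$; for $k\ge 2$ put $Q_{k-1}^{(1)}=\widehat{Q}_{k-1}$, for $\ell=1,\dots,r-2$ put $$Q_{k-1}^{(\ell+1)}=(S+\widehat{Q}_{k-1}Q_{k-1}^{(\ell)})(\widehat{Q}_{k-1}+Q_{k-1}^{(\ell)})^{-1},$$ and finally $$\widehat{Q}_k=(S+\widehat{Q}_{k-1}Q_{k-1}^{(r-1)})(\widehat{Q}_{k-1}+Q_{k-1}^{(r-1)})^{-1}.$$ Convergence terminology (for any matrix norm): $X_k\to X$ sublinearly means $X_k\to X$ and $\lim_{k\to\infty}\|X_{k+1}-X\|/\|X_k-X\|=1$;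 $X_k\to X$ q-linearly with q-factor $\sigma\in(0,1)$ means $X_k\to X$ and $\lim_{k\to\infty}\|X_{k+1}-X\|/\|X_k-X\|=\sigma$. *)

theory Defs
  imports "HOL-Analysis.Analysis" "HOL-Computational_Algebra.Polynomial"
begin

section \<open>Eigenvalues and their multiplicities\<close>

definition eigenvalues :: "complex^'n^'n \<Rightarrow> complex set" where
  "eigenvalues A = {c. \<exists>v. v \<noteq> 0 \<and> A *v v = c *s v}"

text \<open>The characteristic polynomial \<open>det (x I - A)\<close>, as a determinant over the polynomial ring.\<close>

definition charpoly :: "complex^'n^'n \<Rightarrow> complex poly" where
  "charpoly A = det (\<chi> i j. (if i = j then [:0, 1:] else 0) - [:A $ i $ j:])"

definition algebraic_multiplicity :: "complex^'n^'n \<Rightarrow> complex \<Rightarrow> nat" where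
  "algebraic_multiplicity A c = order c (charpoly A)"

text \<open>Here \<^term>\<open>vec.dim\<close> is the dimension over the complex numbers.\<close>

definition geometric_multiplicity :: "complex^'n^'n \<Rightarrow> complex \<Rightarrow> nat" where
  "geometric_multiplicity A c = vec.dim {v. A *v v = c *s v}"

definition semisimple_eigenvalue :: "complex^'n^'n \<Rightarrow> complex \<Rightarrow> bool" where
  "semisimple_eigenvalue A c \<longleftrightarrow>
     c \<in> eigenvalues A \<and> algebraic_multiplicity A c = geometric_multiplicity A c"

definition right_half_plane :: "complex set" where
  "right_half_plane = {z. Re z > 0}"


section \<open>The matrix square root and the iterations\<close>

text \<open>The requirement that 0 be a semisimple eigenvalue of the root includes that it is an
  eigenvalue, so this is the square root of singular matrices only.\<close>

definition matrix_sqrt :: "complex^'n^'n \<Rightarrow> complex^'n^'n" where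
  "matrix_sqrt S = (THE X. X ** X = S \<and> eigenvalues X \<subseteq> right_half_plane \<union> {0} \<and>
     semisimple_eigenvalue X 0)"

text \<open>All sequences below are indexed from 1; the value at index 0 is a dummy.\<close>

fun basic_iter :: "real \<Rightarrow> complex^'n^'n \<Rightarrow> nat \<Rightarrow> complex^'n^'n" where
  "basic_iter \<gamma> S 0 = 0"
| "basic_iter \<gamma> S (Suc 0) = \<gamma> *\<^sub>R mat 1"
| "basic_iter \<gamma> S (Suc (Suc k)) =
     (\<gamma> *\<^sub>R basic_iter \<gamma> S (Suc k) + S) ** matrix_inv (\<gamma> *\<^sub>R mat 1 + basic_iter \<gamma> S (Suc k))"

text \<open>\<open>inner_iter S Q l\<close> is \<open>Q\<^sup>(\<^sup>l\<^sup>)\<close>, started at the current outer iterate \<open>Q\<close>.\<close>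

fun inner_iter :: "complex^'n^'n \<Rightarrow> complex^'n^'n \<Rightarrow> nat \<Rightarrow> complex^'n^'n" where
  "inner_iter S Q 0 = 0"
| "inner_iter S Q (Suc 0) = Q"
| "inner_iter S Q (Suc (Suc l)) =
     (S + Q ** inner_iter S Q (Suc l)) ** matrix_inv (Q + inner_iter S Q (Suc l))"

fun order_iter :: "nat \<Rightarrow> real \<Rightarrow> complex^'n^'n \<Rightarrow> nat \<Rightarrow> complex^'n^'n" where
  "order_iter r \<gamma> S 0 = 0"
| "order_iter r \<gamma> S (Suc 0) = \<gamma> *\<^sub>R mat 1"
| "order_iter r \<gamma> S (Suc (Suc k)) =
     (let Q = order_iter r \<gamma> S (Suc k); W = inner_iter S Q (r - 1)
      in (S + Q ** W) ** matrix_inv (Q + W))"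


section \<open>Convergence\<close>

text \<open>A norm on the complex vector space of square matrices; submultiplicativity is not required.\<close>

definition matrix_norm :: "(complex^'n^'n \<Rightarrow> real) \<Rightarrow> bool" where
  "matrix_norm N \<longleftrightarrow>
     (\<forall>A. 0 \<le> N A) \<and> (\<forall>A. N A = 0 \<longleftrightarrow> A = 0) \<and>
     (\<forall>c A. N (\<chi> i j. c * A $ i $ j) = cmod c * N A) \<and>
     (\<forall>A B. N (A + B) \<le> N A + N B)"

text \<open>Convergence itself does not depend on the norm, the space being finite-dimensional.
  Since \<open>x / 0 = 0\<close>, the nonzero limits of the quotients force \<open>X k \<noteq> L\<close> for all large \<open>k\<close>.\<close>

definition converges_sublinearly ::
  "(complex^'n^'n \<Rightarrow> real) \<Rightarrow> (nat \<Rightarrow> complex^'n^'n) \<Rightarrow> complex^'n^'n \<Rightarrow> bool" where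
  "converges_sublinearly N X L \<longleftrightarrow>
     X \<longlonglongrightarrow> L \<and> (\<lambda>k. N (X (Suc k) - L) / N (X k - L)) \<longlonglongrightarrow> 1"

definition converges_q_linearly ::
  "(complex^'n^'n \<Rightarrow> real) \<Rightarrow> real \<Rightarrow> (nat \<Rightarrow> complex^'n^'n) \<Rightarrow> complex^'n^'n \<Rightarrow> bool" where
  "converges_q_linearly N \<sigma> X L \<longleftrightarrow>
     0 < \<sigma> \<and> \<sigma> < 1 \<and> X \<longlonglongrightarrow> L \<and> (\<lambda>k. N (X (Suc k) - L) / N (X k - L)) \<longlonglongrightarrow> \<sigma>"

end

(*
  Write X for the square root.  The addition formula of the hyperbolic cotangent shows that
  Q_k = X ((g + X)^k + (g - X)^k) / ((g + X)^k - (g - X)^k) satisfies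
  Q_{k+m} (Q_k + Q_m) = S + Q_k Q_m, whence the basic iteration is Q_k and the order-r iteration is
  Q_{r^{k-1}}.  With P the spectral projection onto the kernel of X, Q_k - X equals g/k on the range
  of P and decays geometrically on the kernel of P, so k (Q_k - X) converges to g P, which is
  nonzero; both rates follow.  Everything is a polynomial in X, so the calculations are carried
  out in the polynomial ring modulo an annihilating polynomial z (z - x_1) ... (z - x_p) with Re x_i > 0.
*)
theory Submission
  imports Defs "HOL-Computational_Algebra.Fundamental_Theorem_Algebra"
begin

section \<open>Polynomials in a matrix\<close>

text \<open>The closed form cannot be read literally: \<open>X\<close> is singular, and so is
  \<open>(g + X)^k - (g - X)^k\<close>. As a polynomial, however, that difference is divisible by
  \<open>z\<close>, and the quotient \<open>den k\<close> has the value \<open>2 k g^(k-1)\<close>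
  at 0; this factor \<open>k\<close> is the origin of the error \<open>g/k\<close>. At the other
  roots \<open>den k\<close> is nonzero because \<open>(g - z) / (g + z)\<close> lies in the open
  unit disc for \<open>Re z > 0\<close>. So \<open>den k\<close> is a unit modulo the annihilating
  polynomial, and it may be cancelled. The roots \<open>x_i\<close> may repeat, since nonzero
  eigenvalues can have Jordan blocks; decay is therefore proved by removing one linear factor at a
  time, not by diagonalization. The factor \<open>z\<close> must be simple, which is what
  semisimplicity gives once its definition by multiplicities is turned into a condition on kernels.
  The square root is a definite description, so nothing is known about it before existence and
  uniqueness are settled. Existence comes from interpolation, as a polynomial in
  \<open>S\<close>.\<close>

lemma matrix_diff_ldistrib: "A ** (B - C) = A ** B - A ** (C :: 'a::ring_1^'k^'n)"
  by (simp add: vec_eq_iff matrix_matrix_mult_def sum_subtractf algebra_simps)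

lemma matrix_diff_rdistrib: "(A - B) ** C = A ** C - B ** (C :: 'a::ring_1^'k^'n)"
  by (simp add: vec_eq_iff matrix_matrix_mult_def sum_subtractf algebra_simps)

lemma matrix_add_rdistrib: "(A + B) ** C = A ** C + B ** (C :: 'a::semiring_1^'k^'n)"
  by (simp add: vec_eq_iff matrix_matrix_mult_def sum.distrib distrib_right)

lemma mat_mult_component: "(mat c ** A) $ i $ j = c * (A :: 'a::semiring_1^'k^'n) $ i $ j"
  by (simp add: matrix_matrix_mult_def mat_def if_distrib if_distribR cong: if_cong)

lemma mat_comm: "A ** mat c = mat c ** (A :: 'a::comm_semiring_1^'n^'n)"
  by (simp add: vec_eq_iff matrix_matrix_mult_def mat_def if_distrib if_distribR mult.commute cong: if_cong)

lemma mat_add: "mat (a + b) = mat a + (mat b :: 'a::semiring_1^'n^'n)"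
  by (vector mat_def)

lemma mat_mult: "mat (a * b) = mat a ** (mat b :: 'a::semiring_1^'n^'n)"
  by (simp add: vec_eq_iff mat_mult_component) (simp add: mat_def)

lemma mat_mult_vector: "mat c *v v = c *s (v :: 'a::semiring_1^'n)"
  by (simp add: vec_eq_iff matrix_vector_mult_def mat_def if_distrib if_distribR cong: if_cong)

lemma matrix_vector_mult_smult: "A *v (c *s v) = c *s (A *v (v :: 'a::comm_semiring_1^'n))"
  by (simp add: vec_eq_iff matrix_vector_mult_def sum_distrib_left mult_ac)

definition mat_poly :: "'a::comm_ring_1^'n^'n \<Rightarrow> 'a poly \<Rightarrow> 'a^'n^'n" where
  "mat_poly A p = fold_coeffs (\<lambda>a M. mat a + A ** M) p 0"

lemma mat_poly_0 [simp]: "mat_poly A 0 = 0"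
  by (simp add: mat_poly_def)

lemma mat_poly_pCons [simp]: "mat_poly A (pCons a p) = mat a + A ** mat_poly A p"
  by (cases "p = 0 \<and> a = 0") (auto simp: mat_poly_def)

lemma mat_poly_1 [simp]: "mat_poly A 1 = mat 1"
  by (simp add: one_pCons)

lemma mat_poly_add: "mat_poly A (p + q) = mat_poly A p + mat_poly A q"
  by (induction p q rule: poly_induct2) (simp_all add: mat_add matrix_add_ldistrib)

lemma mat_poly_smult: "mat_poly A (smult c p) = mat c ** mat_poly A p"
proof (induction p)
  case (pCons a p)
  have "A ** (mat c ** mat_poly A p) = mat c ** (A ** mat_poly A p)"
    by (simp only: matrix_mul_assoc mat_comm [of A c])
  then show ?case
    by (simp add: mat_mult matrix_add_ldistrib pCons.IH)
qed simp

lemma mat_poly_diff: "mat_poly A (p - q) = mat_poly A p - mat_poly A q"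
  using mat_poly_add [of A "p - q" q] by simp

lemma mat_poly_mult: "mat_poly A (p * q) = mat_poly A p ** mat_poly A q"
  by (induction p)
    (simp_all add: mat_poly_add mat_poly_smult matrix_add_rdistrib matrix_mul_assoc [symmetric])

lemma mat_poly_sum: "mat_poly A (sum f I) = (\<Sum>i\<in>I. mat_poly A (f i))"
  by (induction I rule: infinite_finite_induct) (simp_all add: mat_poly_add)

lemma mat_poly_commute:
  assumes "B ** A = A ** B"
  shows "B ** mat_poly A p = mat_poly A p ** B"
proof (induction p)
  case (pCons a p)
  have "B ** (A ** mat_poly A p) = A ** (B ** mat_poly A p)"
    by (metis assms matrix_mul_assoc)
  also have "\<dots> = (A ** mat_poly A p) ** B"
    by (simp only: pCons.IH matrix_mul_assoc)
  finally show ?case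
    by (simp only: mat_poly_pCons matrix_add_ldistrib matrix_add_rdistrib mat_comm [of B a])
qed simp

lemma mat_poly_dvd:
  assumes "mat_poly A f = 0" "f dvd p"
  shows "mat_poly A p = 0"
  using assms by (auto simp: mat_poly_mult)

lemma mat_poly_eq_if_dvd_diff:
  assumes "mat_poly A f = 0" "f dvd p - q"
  shows "mat_poly A p = mat_poly A q"
  using mat_poly_dvd [OF assms] by (simp add: mat_poly_diff)

lemma mat_poly_eigenvector:
  assumes "A *v v = c *s v"
  shows "mat_poly A p *v v = poly p c *s v"
proof (induction p)
  case (pCons a p)
  have "(A ** mat_poly A p) *v v = A *v (poly p c *s v)"
    by (simp add: matrix_vector_mul_assoc [symmetric] pCons.IH)
  then show ?case
    by (simp add: matrix_vector_mult_add_rdistrib mat_mult_vector matrix_vector_mult_smult assms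
        vector_sadd_rdistrib vector_smult_assoc mult.commute)
qed simp

lemma mat_poly_factor_vector: "mat_poly A [:- c, 1:] *v v = A *v v - c *s v"
  by (simp add: matrix_vector_mult_add_rdistrib mat_mult_vector vec_eq_iff)

section \<open>Annihilating polynomials whose roots are eigenvalues\<close>

abbreviation root_poly :: "complex list \<Rightarrow> complex poly" where
  "root_poly L \<equiv> prod_list (map (\<lambda>c. [:- c, 1:]) L)"

lemma poly_root_poly_eq_0_iff: "poly (root_poly L) c = 0 \<longleftrightarrow> c \<in> set L"
  by (induction L) auto

lemma scaleR_eq_mat: "a *\<^sub>R A = mat (complex_of_real a) ** (A :: complex^'n^'k)"
  by (simp add: vec_eq_iff mat_mult_component scaleR_conv_of_real [where 'a = complex])

lemma eigenvalues_iff_singular: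
  "c \<in> eigenvalues A \<longleftrightarrow> \<not> invertible (mat_poly A [:- c, 1:])"
proof -
  have "invertible (mat_poly A [:- c, 1:]) \<longleftrightarrow> (\<forall>v. mat_poly A [:- c, 1:] *v v = 0 \<longrightarrow> v = 0)"
    by (simp only: invertible_left_inverse matrix_left_invertible_ker)
  also have "\<dots> \<longleftrightarrow> (\<forall>v. A *v v = c *s v \<longrightarrow> v = 0)"
    by (simp only: mat_poly_factor_vector right_minus_eq)
  finally show ?thesis
    unfolding eigenvalues_def by blast
qed

text \<open>The matrices form a space of finite real dimension, so enough powers of \<open>A\<close>
  are linearly dependent, even over the reals.\<close>

lemma exists_annihilating_poly:
  fixes A :: "complex^'n^'n"
  obtains p where "p \<noteq> 0" "mat_poly A p = 0"
proof -
  define f where "f i = mat_poly A (monom 1 i)" for i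
  define n where "n = DIM(complex^'n^'n)"
  show thesis
  \<comment> \<open>Dependence is a property of the set of powers, in which equal powers collapse;
    that case is treated apart.\<close>
  proof (cases "inj_on f {..n}")
    case False
    then obtain i j where ij: "i \<noteq> j" "f i = f j"
      by (auto simp: inj_on_def)
    show thesis
    proof (rule that)
      show "monom (1::complex) i - monom 1 j \<noteq> 0"
        using ij(1) by (simp add: poly_eq_iff) (metis zero_neq_one)
      show "mat_poly A (monom 1 i - monom 1 j) = 0"
        using ij(2) by (simp add: mat_poly_diff f_def)
    qed
  next
    case True
    then have "card (f ` {..n}) > n"
      by (simp add: card_image)
    then have "dependent (f ` {..n})"
      using independent_card_le_dim dependent_biggerset n_def by blast
    then obtain u v where u: "(\<Sum>v\<in>f ` {..n}. u v *\<^sub>R v) = 0" "v \<in> f ` {..n}" "u v \<noteq> 0"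
      by (auto simp: dependent_finite)
    then obtain k where k: "k \<le> n" "u (f k) \<noteq> 0"
      by auto
    define p where "p = (\<Sum>i\<le>n. monom (complex_of_real (u (f i))) i)"
    show thesis
    proof (rule that)
      have "coeff p k = of_real (u (f k))"
        using k(1) by (simp add: p_def coeff_sum if_distrib cong: if_cong)
      then show "p \<noteq> 0"
        using k(2) by auto
      have "mat_poly A (monom (complex_of_real c) i) = c *\<^sub>R f i" for c i
        using mat_poly_smult [of A "complex_of_real c" "monom 1 i"]
        by (simp add: smult_monom f_def scaleR_eq_mat)
      then have "mat_poly A p = (\<Sum>i\<le>n. u (f i) *\<^sub>R f i)"
        by (simp add: p_def mat_poly_sum)
      also have "\<dots> = (\<Sum>v\<in>f ` {..n}. u v *\<^sub>R v)"
        using True by (simp add: sum.reindex)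
      finally show "mat_poly A p = 0"
        using u(1) by simp
    qed
  qed
qed

text \<open>A linear factor whose root is not an eigenvalue gives an invertible matrix and can be
  cancelled. Roots may repeat, hence a list.\<close>

lemma annihilating_eigenvalue_list:
  fixes A :: "complex^'n^'n"
  obtains L where "set L \<subseteq> eigenvalues A" "mat_poly A (root_poly L) = 0"
proof -
  \<comment> \<open>\<open>p\<close> is still to be factored; \<open>q\<close> collects the factors
    already found to belong to eigenvalues.\<close>
  have "\<exists>L. set L \<subseteq> eigenvalues A \<and> mat_poly A (root_poly L * q) = 0"
    if "p \<noteq> 0" "mat_poly A (p * q) = 0" for p q
    using that
  proof (induction "degree p" arbitrary: p q)
    case 0
    then obtain a where a: "p = [:a:]"
      by (metis degree_eq_zeroE)
    with 0 have "a \<noteq> 0"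
      by auto
    have "q = smult (1 / a) (p * q)"
      using \<open>a \<noteq> 0\<close> by (simp add: a)
    then have "mat_poly A q = mat (1 / a) ** mat_poly A (p * q)"
      by (metis mat_poly_smult)
    then show ?case
      using 0 by (intro exI [of _ "[]"]) simp
  next
    case (Suc d)
    then have "degree p \<noteq> 0" by simp
    then have "\<not> constant (poly p)"
      by (simp add: constant_degree)
    then obtain c where "poly p c = 0"
      using fundamental_theorem_of_algebra by blast
    then obtain p' where p': "p = [:- c, 1:] * p'"
      by (auto simp: poly_eq_0_iff_dvd elim: dvdE)
    with Suc have p'0: "p' \<noteq> 0"
      by auto
    then have deg: "d = degree p'"
      using Suc.hyps(2) p' degree_mult_eq [of "[:- c, 1:]" p'] by (simp del: mult_pCons_left)
    show ?case
    proof (cases "c \<in> eigenvalues A")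
      case True
      have "mat_poly A (p' * ([:- c, 1:] * q)) = 0"
        using Suc.prems(2) by (simp only: p' ac_simps)
      then obtain L where "set L \<subseteq> eigenvalues A" "mat_poly A (root_poly L * ([:- c, 1:] * q)) = 0"
        using Suc.hyps(1) [OF deg p'0] by blast
      then show ?thesis
        using True by (intro exI [of _ "c # L"]) (simp add: ac_simps del: mult_pCons_left mult_pCons_right)
    next
      case False
      then obtain B where "B ** mat_poly A [:- c, 1:] = mat 1"
        by (auto simp: eigenvalues_iff_singular invertible_def)
      moreover have "mat_poly A [:- c, 1:] ** mat_poly A (p' * q) = 0"
        using Suc.prems(2) by (simp only: p' mat_poly_mult matrix_mul_assoc)
      ultimately have "mat 1 ** mat_poly A (p' * q) = 0"
        by (metis matrix_mul_assoc times0_right)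
      then have "mat_poly A (p' * q) = 0"
        by simp
      then show ?thesis
        using Suc.hyps(1) [OF deg p'0] by blast
    qed
  qed
  note main = this
  obtain p where "p \<noteq> 0" "mat_poly A p = 0"
    using exists_annihilating_poly .
  then obtain L where "set L \<subseteq> eigenvalues A" "mat_poly A (root_poly L * 1) = 0"
    using main [of p 1] by (metis mult.right_neutral)
  then show thesis
    by (intro that [of L]) (simp_all only: mult.right_neutral)
qed

text \<open>Every eigenvalue is a root of each annihilating polynomial.\<close>

lemma finite_eigenvalues: "finite (eigenvalues A)"
proof -
  obtain L where L: "mat_poly A (root_poly L) = 0"
    using annihilating_eigenvalue_list .
  have "c \<in> set L" if "c \<in> eigenvalues A" for c
  proof -
    from that have "\<exists>v. v \<noteq> 0 \<and> A *v v = c *s v"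
      by (simp only: eigenvalues_def mem_Collect_eq)
    then obtain v where "v \<noteq> 0" "A *v v = c *s v"
      by blast
    then have "poly (root_poly L) c *s v = 0"
      by (metis L mat_poly_eigenvector matrix_vector_mult_0)
    with \<open>v \<noteq> 0\<close> have "poly (root_poly L) c = 0"
      by (simp only: vector_mul_eq_0) simp
    then show ?thesis
      by (simp add: poly_root_poly_eq_0_iff)
  qed
  then show ?thesis
    by (intro finite_subset [OF _ finite_set [of L]]) auto
qed

text \<open>\<open>V\<close> need only be closed under \<open>v \<mapsto> A v - c v\<close>; it stands for a common invariant subspace.\<close>

lemma eigenvector_in_invariant_set:
  assumes "mat_poly A (root_poly L) *v w = 0" "w \<noteq> 0" "V w"
    and inv: "\<And>v c. V v \<Longrightarrow> V (A *v v - c *s v)"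
  shows "\<exists>v c. v \<noteq> 0 \<and> V v \<and> c \<in> set L \<and> A *v v = c *s v"
  using assms(1-3)
proof (induction L arbitrary: w)
  case Nil
  then show ?case by simp
next
  case (Cons c L)
  \<comment> \<open>The factors are applied to \<open>w\<close> one by one; the last vector before 0
    is an eigenvector.\<close>
  define u where "u = A *v w - c *s w"
  have "mat_poly A (root_poly L) *v u = mat_poly A (root_poly L * [:- c, 1:]) *v w"
    by (simp only: mat_poly_mult matrix_vector_mul_assoc [symmetric] mat_poly_factor_vector u_def)
  also have "\<dots> = 0"
    using Cons.prems(1) by (simp only: list.map prod_list.Cons mult.commute)
  finally have *: "mat_poly A (root_poly L) *v u = 0" .
  show ?case
  proof (cases "u = 0")
    case True
    then show ?thesis
      using Cons.prems(2,3) by (intro exI [of _ w] exI [of _ c]) (simp add: u_def)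
  next
    case False
    then show ?thesis
      using Cons.IH [OF * False] inv [OF Cons.prems(3)] by (auto simp: u_def)
  qed
qed

section \<open>Semisimple zero eigenvalues\<close>

definition const_poly_matrix :: "complex^'n^'n \<Rightarrow> complex poly^'n^'n" where
  "const_poly_matrix A = (\<chi> i j. [:A $ i $ j:])"

lemma const_poly_sum: "(\<Sum>i\<in>I. [:f i:]) = [:\<Sum>i\<in>I. f i:]"
  by (induction I rule: infinite_finite_induct) auto

lemma const_poly_matrix_mult:
  "const_poly_matrix (A ** B) = const_poly_matrix A ** const_poly_matrix B"
  by (simp add: const_poly_matrix_def matrix_matrix_mult_def vec_eq_iff const_poly_sum mult.commute)

lemma const_poly_matrix_1: "const_poly_matrix (mat 1) = mat 1"
  by (simp add: const_poly_matrix_def vec_eq_iff mat_def one_pCons)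

lemma poly_det: "poly (det M) x = det (\<chi> i j. poly (M $ i $ j) x)"
  by (simp add: det_def poly_sum poly_prod)

lemma charpoly_eq: "charpoly A = det (mat [:0, 1:] - const_poly_matrix A)"
  unfolding charpoly_def const_poly_matrix_def mat_def
  by (rule arg_cong [of _ _ det]) (simp add: vec_eq_iff)

lemma poly_charpoly: "poly (charpoly A) c = det (mat c - A)"
  unfolding charpoly_def poly_det
  by (rule arg_cong [of _ _ det]) (simp add: vec_eq_iff mat_def)

text \<open>At a point that is not an eigenvalue the determinant does not vanish. This makes the
  order at 0 meaningful.\<close>

lemma charpoly_nonzero: "charpoly A \<noteq> 0"
proof -
  obtain c where c: "c \<notin> eigenvalues A"
    using ex_new_if_finite [OF infinite_UNIV_char_0 finite_eigenvalues] by blast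
  have "(mat c - A) *v v = 0 \<Longrightarrow> v = 0" for v
    using c by (auto simp: eigenvalues_def matrix_vector_mult_diff_rdistrib mat_mult_vector)
  then have "invertible (mat c - A)"
    unfolding invertible_left_inverse matrix_left_invertible_ker by blast
  then have "poly (charpoly A) c \<noteq> 0"
    by (simp add: poly_charpoly invertible_det_nz)
  then show ?thesis
    by auto
qed

definition coord_proj :: "'n set \<Rightarrow> complex^'n^'n" where
  "coord_proj I = (\<chi> i j. if i = j \<and> i \<in> I then 1 else 0)"

lemma coord_proj_mult_vector: "coord_proj I *v x = (\<chi> i. if i \<in> I then x $ i else 0)"
proof -
  have "(\<Sum>j\<in>UNIV. (if i = j \<and> i \<in> I then 1 else 0) * x $ j) = (if i \<in> I then x $ i else 0)" for i
    by (cases "i \<in> I") (simp_all add: if_distrib if_distribR cong: if_cong)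
  then show ?thesis
    by (simp add: coord_proj_def vec_eq_iff matrix_vector_mult_def)
qed

text \<open>A basis of the kernel is extended to a basis of the space, the columns of
  \<open>V\<close>; \<open>I\<close> marks the kernel vectors among them. The factors of the
  projection are kept visible because a determinant is later computed by conjugation with
  \<open>V\<close>.\<close>

lemma kernel_projection:
  fixes A :: "complex^'n^'n"
  obtains V V' :: "complex^'n^'n" and I where
    "V ** V' = mat 1" "V' ** V = mat 1"
    "card I = vec.dim {v. A *v v = 0}"
    "A ** (V ** coord_proj I ** V') = 0"
    "\<And>v. A *v v = 0 \<Longrightarrow> (V ** coord_proj I ** V') *v v = v"
proof -
  define K where "K = {v. A *v v = 0}"
  have subK: "vec.subspace K"
    by (auto simp: vec.subspace_def K_def matrix_vector_right_distrib matrix_vector_mult_smult)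
  obtain B0 where B0: "B0 \<subseteq> K" "vec.independent B0" "K \<subseteq> vec.span B0" "card B0 = vec.dim K"
    using vec.basis_exists by blast
  obtain B where B: "B0 \<subseteq> B" "vec.independent B" "UNIV \<subseteq> vec.span B"
    by (rule vec.maximal_independent_subset_extend [OF subset_UNIV B0(2)])
  have finB: "finite B"
    by (rule vec.finiteI_independent [OF B(2)])
  have "vec.span B = vec.span UNIV"
    unfolding vec.span_UNIV using B(3) by (rule subset_antisym [OF subset_UNIV])
  then have cardB: "card B = CARD('n)"
    using vec.dim_eq_card [OF _ B(2)] by (metis vec_dim_card)
  then obtain f where f: "bij_betw f (UNIV :: 'n set) B"
    using finite_same_card_bij [of "UNIV :: 'n set" B] finB by auto
  define I where "I = {i. f i \<in> B0}"
  have "f ` I = B0"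
    using f B(1) unfolding I_def bij_betw_def by auto
  then have cardI: "card I = vec.dim K"
    using B0(4) card_image [OF inj_on_subset [OF bij_betw_imp_inj_on [OF f] subset_UNIV], of I]
    by (simp only:)
  define V :: "complex^'n^'n" where "V = (\<chi> i j. f j $ i)"
  have colV: "V *v x = (\<Sum>j\<in>UNIV. x $ j *s f j)" for x
    by (simp add: V_def vec_eq_iff matrix_vector_mult_def mult.commute)
  have "V *v x = 0 \<Longrightarrow> x = 0" for x
  proof -
    assume "V *v x = 0"
    then have "(\<Sum>b\<in>B. x $ (inv_into UNIV f b) *s b) = 0"
      using colV [of x] f
      by (subst sum.reindex_bij_betw [OF f, symmetric]) (simp add: bij_betw_def inv_into_f_f)
    then have "x $ inv_into UNIV f b = 0" if "b \<in> B" for b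
      using vec.independentD [OF B(2) finB order_refl _ that, of "\<lambda>b. x $ inv_into UNIV f b"] by blast
    moreover have "f j \<in> B" "inv_into UNIV f (f j) = j" for j
      using f by (auto simp: bij_betw_def)
    ultimately have "x $ j = 0" for j
      by (metis (no_types))
    then show "x = 0"
      by (simp add: vec_eq_iff)
  qed
  then obtain V' where V': "V' ** V = mat 1"
    using matrix_left_invertible_ker by blast
  then have V'': "V ** V' = mat 1"
    by (simp add: matrix_left_right_inverse)
  show thesis
  proof (rule that [OF V'' V'])
    show "card I = vec.dim {v. A *v v = 0}"
      using cardI by (simp add: K_def)
    define E :: "complex^'n^'n" where "E = coord_proj I"
    define P where "P = V ** E ** V'"
    have Ev: "E *v x = (\<chi> i. if i \<in> I then x $ i else 0)" for x
      by (simp add: E_def coord_proj_mult_vector)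
    have VE: "V *v (E *v x) \<in> K" for x
      unfolding colV Ev
      by (rule vec.subspace_sum [OF subK])
        (use B0(1) in \<open>auto simp: I_def intro!: vec.subspace_scale [OF subK] vec.subspace_0 [OF subK]\<close>)
    have "(A ** P) *v x = 0" for x
      using VE [of "V' *v x"] by (simp add: P_def K_def matrix_vector_mul_assoc [symmetric])
    then show "A ** (V ** coord_proj I ** V') = 0"
      by (simp add: matrix_eq P_def E_def)
    show "(V ** coord_proj I ** V') *v v = v" if "A *v v = 0" for v
    proof -
      have "v \<in> vec.span (f ` I)"
        using that B0(3) \<open>f ` I = B0\<close> by (auto simp: K_def)
      \<comment> \<open>\<open>x\<close> is the coordinate vector of \<open>v\<close>, supported in
        \<open>I\<close> since \<open>v\<close> is a combination of kernel basis vectors.\<close>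
      then have "\<exists>x. v = V *v x \<and> E *v x = x"
      proof (induction rule: vec.span_induct_alt)
        case base
        then show ?case
          by (intro exI [of _ 0]) simp
      next
        case (step c b w)
        then obtain i x where ix: "i \<in> I" "b = f i" "w = V *v x" "E *v x = x"
          by auto
        have "V *v axis i 1 = b"
          by (simp add: ix V_def vec_eq_iff matrix_vector_mult_def axis_def if_distrib if_distribR cong: if_cong)
        moreover have "E *v axis i 1 = axis i 1"
          using ix(1) by (auto simp: Ev vec_eq_iff axis_def)
        ultimately show ?case
          using ix
          by (intro exI [of _ "c *s axis i 1 + x"])
            (simp add: matrix_vector_right_distrib matrix_vector_mult_smult)
      qed
      then obtain x where x: "v = V *v x" "E *v x = x"
        by blast
      have "(V ** coord_proj I ** V') *v v = V *v (E *v ((V' ** V) *v x))"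
        by (simp only: E_def x(1) matrix_vector_mul_assoc matrix_mul_assoc)
      then show ?thesis
        using x V' by simp
    qed
  qed
qed

lemma order_0_eq:
  fixes q :: "complex poly"
  assumes "p = q * [:0, 1:] ^ d" "p \<noteq> 0"
  shows "order 0 p = d \<longleftrightarrow> poly q 0 \<noteq> 0"
proof -
  have "order 0 p = order 0 q + d"
    using assms order_mult [of q "[:0, 1:] ^ d" 0] order_power_n_n [of 0 d] by simp
  moreover have "q \<noteq> 0"
    using assms by auto
  ultimately show ?thesis
    using order_root [of q 0] by auto
qed

text \<open>With a projection \<open>P\<close> onto the kernel, \<open>z I - A = (P - A + z (I - P)) (I - P + z P)\<close> splits off the
  factor \<open>z\<^sup>d\<close>, \<open>d\<close> the geometric multiplicity, from the characteristic polynomial.\<close>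

lemma semisimple_0_iff:
  fixes A :: "complex^'n^'n"
  shows "semisimple_eigenvalue A 0 \<longleftrightarrow>
    \<not> invertible A \<and> (\<forall>v. A *v (A *v v) = 0 \<longrightarrow> A *v v = 0)"
proof -
  obtain V V' :: "complex^'n^'n" and I where V: "V ** V' = mat 1" "V' ** V = mat 1"
    and cardI: "card I = vec.dim {v. A *v v = 0}"
    and AP': "A ** (V ** coord_proj I ** V') = 0"
    and P_ker': "\<And>v. A *v v = 0 \<Longrightarrow> (V ** coord_proj I ** V') *v v = v"
    using kernel_projection [of A] by blast
  define E :: "complex^'n^'n" where "E = coord_proj I"
  define P where "P = V ** E ** V'"
  have AP: "A ** P = 0" and P_ker: "\<And>v. A *v v = 0 \<Longrightarrow> P *v v = v"
    using AP' P_ker' by (simp_all only: P_def E_def)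
  have PP: "P ** P = P"
  proof -
    have "A *v (P *v v) = 0" for v
      by (simp add: matrix_vector_mul_assoc AP)
    then show ?thesis
      by (simp add: matrix_eq matrix_vector_mul_assoc [symmetric] P_ker)
  qed
  define Z :: "complex poly^'n^'n" where "Z = mat [:0, 1:]"
  let ?c = "const_poly_matrix"
  define Q where "Q = mat 1 - ?c P"
  have cPP: "?c P ** ?c P = ?c P"
    by (simp add: const_poly_matrix_mult [symmetric] PP)
  have cAP: "?c A ** ?c P = 0"
    by (simp add: const_poly_matrix_mult [symmetric] AP) (simp add: const_poly_matrix_def vec_eq_iff)
  have "(?c P - ?c A + Z ** Q) ** (Q + Z ** ?c P) = Z - ?c A"
  proof -
    have PQ: "?c P ** Q = 0" and QP: "Q ** ?c P = 0" and AQ: "?c A ** Q = ?c A" and QQ: "Q ** Q = Q"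
      by (simp_all add: Q_def matrix_diff_ldistrib matrix_diff_rdistrib cPP cAP)
    have Zc: "X ** Z = Z ** X" for X
      by (simp add: Z_def mat_comm)
    have Zc': "X ** (Z ** Y) = Z ** (X ** Y)" for X Y
      by (simp only: matrix_mul_assoc Zc)
    have 1: "(Z ** Q) ** Q = Z ** Q" "(Z ** Q) ** (Z ** ?c P) = 0" "?c P ** (Z ** ?c P) = Z ** ?c P"
      "?c A ** (Z ** ?c P) = 0"
      by (simp_all only: Zc' [of Q] Zc' [of "?c P"] Zc' [of "?c A"] matrix_mul_assoc [symmetric]
          QQ QP cPP cAP times0_right)
    have "Z ** Q + Z ** ?c P = Z"
      by (simp add: Q_def matrix_diff_ldistrib)
    then show ?thesis
      by (simp add: matrix_add_ldistrib matrix_add_rdistrib matrix_diff_ldistrib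
          matrix_diff_rdistrib 1 PQ AQ)
  qed
  then have "charpoly A = det (?c P - ?c A + Z ** Q) * det (Q + Z ** ?c P)"
    by (simp add: charpoly_eq det_mul [symmetric] Z_def)
  moreover have "det (Q + Z ** ?c P) = [:0, 1:] ^ card I"
  proof -
    \<comment> \<open>In the basis \<open>V\<close> the second factor is diagonal, with
      \<open>z\<close> at the indices in \<open>I\<close> and 1 elsewhere.\<close>
    define D where "D = mat 1 - ?c E + Z ** ?c E"
    have D_diag: "D $ i $ j = (if i = j then if i \<in> I then [:0, 1:] else 1 else 0)" for i j
      by (auto simp: D_def Z_def mat_mult_component const_poly_matrix_def E_def coord_proj_def)
        (simp_all add: mat_def one_pCons)
    have VV: "?c V ** ?c V' = mat 1"
      by (simp add: const_poly_matrix_mult [symmetric] V const_poly_matrix_1)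
    have "?c V ** (Z ** ?c E) ** ?c V' = Z ** ?c P"
      by (simp only: P_def const_poly_matrix_mult matrix_mul_assoc Z_def mat_comm [of "?c V"])
    then have "Q + Z ** ?c P = ?c V ** D ** ?c V'"
      by (simp add: D_def Q_def matrix_add_ldistrib matrix_add_rdistrib matrix_diff_ldistrib
          matrix_diff_rdistrib VV P_def const_poly_matrix_mult)
    then have "det (Q + Z ** ?c P) = det (?c V) * det D * det (?c V')"
      by (simp add: det_mul)
    also have "\<dots> = det D * det (?c V ** ?c V')"
      by (simp add: det_mul mult_ac)
    also have "\<dots> = det D"
      by (simp add: VV)
    also have "\<dots> = (\<Prod>i\<in>UNIV. D $ i $ i)"
      by (rule det_diagonal) (simp add: D_diag)
    also have "\<dots> = (\<Prod>i\<in>UNIV. if i \<in> I then [:0, 1:] else 1)"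
      by (simp add: D_diag)
    also have "\<dots> = [:0, 1:] ^ card I"
      by (simp add: prod.If_cases)
    finally show ?thesis .
  qed
  ultimately have "order 0 (charpoly A) = card I \<longleftrightarrow> poly (det (?c P - ?c A + Z ** Q)) 0 \<noteq> 0"
    by (intro order_0_eq charpoly_nonzero) simp
  \<comment> \<open>At \<open>z = 0\<close> the first factor has determinant
    \<open>det (P - A)\<close>, so the two multiplicities agree exactly when \<open>P - A\<close> is
    injective.\<close>
  also have "poly (det (?c P - ?c A + Z ** Q)) 0 = det (P - A)"
    unfolding poly_det Z_def
    by (rule arg_cong [of _ _ det]) (simp add: vec_eq_iff mat_mult_component const_poly_matrix_def)
  also have "det (P - A) \<noteq> 0 \<longleftrightarrow> (\<forall>v. (P - A) *v v = 0 \<longrightarrow> v = 0)"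
    by (simp only: invertible_det_nz [symmetric] invertible_left_inverse matrix_left_invertible_ker)
  also have "\<dots> \<longleftrightarrow> (\<forall>v. A *v (A *v v) = 0 \<longrightarrow> A *v v = 0)"
  proof safe
    fix v
    assume inj: "\<forall>v. (P - A) *v v = 0 \<longrightarrow> v = 0" and v: "A *v (A *v v) = 0"
    \<comment> \<open>This choice puts \<open>v + x\<close> into the kernel of \<open>P - A\<close>:
      since \<open>A x = 0\<close>, also \<open>P x = x\<close>, and
      \<open>P (v + x) = A v = A (v + x)\<close>.\<close>
    define x where "x = A *v v - P *v v"
    have "A *v x = 0"
      by (simp add: x_def matrix_vector_mult_diff_distrib v) (simp add: matrix_vector_mul_assoc AP)
    then have "(P - A) *v (v + x) = 0"
      by (simp add: matrix_vector_right_distrib matrix_vector_mult_diff_rdistrib P_ker) (simp add: x_def)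
    then have "v + x = 0"
      using inj by blast
    then have "v = - x"
      by (simp add: eq_neg_iff_add_eq_0)
    then show "A *v v = 0"
      using \<open>A *v x = 0\<close> by (simp add: vec.neg)
  next
    fix v
    assume ker: "\<forall>v. A *v (A *v v) = 0 \<longrightarrow> A *v v = 0" and v: "(P - A) *v v = 0"
    then have PA: "P *v v = A *v v"
      by (simp add: matrix_vector_mult_diff_rdistrib)
    have "A *v (P *v v) = 0"
      by (simp add: matrix_vector_mul_assoc AP)
    then have "A *v v = 0"
      using ker PA by simp
    then show "v = 0"
      using P_ker PA by metis
  qed
  finally have "order 0 (charpoly A) = card I \<longleftrightarrow> (\<forall>v. A *v (A *v v) = 0 \<longrightarrow> A *v v = 0)" .
  moreover have "0 \<in> eigenvalues A \<longleftrightarrow> \<not> invertible A"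
    unfolding eigenvalues_def invertible_left_inverse matrix_left_invertible_ker by auto
  ultimately show ?thesis
    by (simp add: semisimple_eigenvalue_def algebraic_multiplicity_def geometric_multiplicity_def cardI)
qed

section \<open>The matrix square root\<close>

lemma annihilating_list_semisimple:
  fixes A :: "complex^'n^'n"
  assumes "semisimple_eigenvalue A 0"
  obtains L where "set L \<subseteq> eigenvalues A - {0}" "mat_poly A ([:0, 1:] * root_poly L) = 0"
proof -
  have A: "mat_poly A [:0, 1:] = A"
    by simp
  have cancel: "mat_poly A ([:0, 1:] * p) = 0" if "mat_poly A ([:0, 1:] * ([:0, 1:] * p)) = 0" for p
  proof -
    have "A ** (A ** mat_poly A p) = 0"
      using that by (simp only: mat_poly_mult A)
    then have "A *v (A *v (mat_poly A p *v v)) = 0" for v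
      by (metis matrix_vector_mul_assoc matrix_vector_mult_0)
    then have "A *v (mat_poly A p *v v) = 0" for v
      using assms unfolding semisimple_0_iff by blast
    then have "A ** mat_poly A p = 0"
      by (simp add: matrix_eq matrix_vector_mul_assoc [symmetric])
    then show ?thesis
      by (simp only: mat_poly_mult A)
  qed
  \<comment> \<open>For \<open>j = 0\<close> a factor \<open>z\<close> is added, for
    \<open>j > 1\<close> the surplus ones are cancelled.\<close>
  have pow: "mat_poly A ([:0, 1:] * p) = 0" if "mat_poly A ([:0, 1:] ^ j * p) = 0" for j p
    using that
  proof (induction j)
    case 0
    then show ?case
      by (simp only: power_0 mult_1 mat_poly_mult times0_right)
  next
    case (Suc j)
    show ?case
    proof (cases j)
      case 0
      then show ?thesis
        using Suc.prems by (simp only: power_Suc power_0 mult_1_right)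
    next
      case (Suc i)
      have "mat_poly A ([:0, 1:] * ([:0, 1:] * ([:0, 1:] ^ i * p))) = 0"
        using \<open>mat_poly A ([:0, 1:] ^ Suc j * p) = 0\<close> by (simp only: Suc power_Suc mult.assoc)
      then have "mat_poly A ([:0, 1:] ^ j * p) = 0"
        unfolding Suc power_Suc mult.assoc by (rule cancel)
      then show ?thesis
        by (rule Suc.IH)
    qed
  qed
  have split: "\<exists>j. root_poly L = [:0, 1:] ^ j * root_poly (filter (\<lambda>c. c \<noteq> 0) L)" for L
  proof (induction L)
    case Nil
    show ?case
      by (intro exI [of _ 0]) simp
  next
    case (Cons c L)
    then obtain j where j: "root_poly L = [:0, 1:] ^ j * root_poly (filter (\<lambda>c. c \<noteq> 0) L)" ..
    show ?case
    proof (cases "c = 0")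
      case True
      then show ?thesis
        by (intro exI [of _ "Suc j"])
          (simp only: list.map prod_list.Cons j filter.simps minus_zero power_Suc mult.assoc
            not_True_eq_False if_False refl simp_thms)
    next
      case False
      then show ?thesis
        by (intro exI [of _ j]) (simp only: list.map prod_list.Cons j filter.simps if_True simp_thms mult.left_commute)
    qed
  qed
  obtain L where L: "set L \<subseteq> eigenvalues A" "mat_poly A (root_poly L) = 0"
    by (rule annihilating_eigenvalue_list)
  obtain j where "root_poly L = [:0, 1:] ^ j * root_poly (filter (\<lambda>c. c \<noteq> 0) L)"
    using split by blast
  then have "mat_poly A ([:0, 1:] * root_poly (filter (\<lambda>c. c \<noteq> 0) L)) = 0"
    using L(2) by (intro pow [of j]) (simp only:)
  moreover have "set (filter (\<lambda>c. c \<noteq> 0) L) \<subseteq> eigenvalues A - {0}"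
    using L(1) by auto
  ultimately show thesis
    by (intro that)
qed

text \<open>Newton--Hensel lifting, one root at a time: the correction \<open>c f\<close> keeps the congruence modulo \<open>f\<close>,
  and \<open>c\<close> is chosen to gain one further root \<open>m\<close>.\<close>

lemma exists_poly_sqrt_mod:
  assumes "0 \<notin> set L"
  shows "\<exists>s. [:0, 1:] * root_poly L dvd s * s - [:0, 1:] \<and> poly s 0 = 0 \<and>
    (\<forall>c\<in>set L. poly s c = csqrt c)"
  using assms
proof (induction L)
  case Nil
  show ?case
    by (intro exI [of _ 0]) (simp del: minus_pCons)
next
  case (Cons m L)
  define f where "f = [:0, 1:] * root_poly L"
  obtain s where s: "f dvd s * s - [:0, 1:]" "poly s 0 = 0" "\<forall>c\<in>set L. poly s c = csqrt c"
    using Cons by (auto simp: f_def)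
  then obtain g where g: "s * s - [:0, 1:] = f * g"
    by (auto elim: dvdE)
  have froot: "poly f c = 0 \<longleftrightarrow> c = 0 \<or> c \<in> set L" for c
    by (simp add: f_def poly_root_poly_eq_0_iff)
  have "m \<noteq> 0"
    using Cons.prems by auto
  \<comment> \<open>If \<open>m\<close> is an old root, the value of \<open>s\<close> there is
    already right and nonzero, and \<open>c\<close> solves the linear equation
    \<open>g + 2 c s = 0\<close> at \<open>m\<close>. If \<open>m\<close> is new, \<open>c\<close>
    interpolates the value \<open>csqrt m\<close>, and the first condition follows because
    \<open>f\<close> does not vanish at \<open>m\<close>.\<close>
  obtain c where c: "poly (g + smult (2 * c) s + smult (c\<^sup>2) f) m = 0" "poly (s + smult c f) m = csqrt m"
  proof (cases "poly f m = 0")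
    case True
    then have sm: "poly s m = csqrt m"
      using froot s(3) \<open>m \<noteq> 0\<close> by auto
    then have "poly s m \<noteq> 0"
      using \<open>m \<noteq> 0\<close> by simp
    then show thesis
      by (intro that [of "- poly g m / (2 * poly s m)"]) (simp_all add: True sm)
  next
    case False
    define c where "c = (csqrt m - poly s m) / poly f m"
    have sm: "poly (s + smult c f) m = csqrt m"
      using False by (simp add: c_def)
    have "poly f m * poly (g + smult (2 * c) s + smult (c\<^sup>2) f) m =
        poly (f * g) m + 2 * c * poly s m * poly f m + c\<^sup>2 * (poly f m)\<^sup>2"
      by (simp add: algebra_simps power2_eq_square)
    also have "\<dots> = (poly (s + smult c f) m)\<^sup>2 - m"
      unfolding g [symmetric] by (simp add: algebra_simps power2_eq_square)
    also have "\<dots> = 0"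
      unfolding sm by simp
    finally show thesis
      using False sm by (intro that [of c]) simp_all
  qed
  define h where "h = g + smult (2 * c) s + smult (c\<^sup>2) f"
  define t where "t = s + smult c f"
  have "smult (2 * c) s = smult c s + smult c s"
    by (metis mult_2 smult_add_left)
  then have "t * t = s * s + f * (smult (2 * c) s + smult (c\<^sup>2) f)"
    by (simp add: t_def ring_distribs power2_eq_square mult_ac)
  moreover have "f * h = f * g + f * (smult (2 * c) s + smult (c\<^sup>2) f)"
    by (simp only: h_def ring_distribs add.assoc)
  ultimately have "t * t - [:0, 1:] = f * h"
    unfolding g [symmetric] by (simp only: diff_add_eq)
  moreover have "[:- m, 1:] dvd h"
    using c(1) by (simp only: h_def poly_eq_0_iff_dvd)
  ultimately have "f * [:- m, 1:] dvd t * t - [:0, 1:]"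
    by (simp only: mult_dvd_mono dvd_refl)
  then have "[:0, 1:] * root_poly (m # L) dvd t * t - [:0, 1:]"
    by (simp only: f_def list.map prod_list.Cons mult_ac)
  moreover have "poly t 0 = 0" "\<forall>c\<in>set L. poly t c = csqrt c" "poly t m = csqrt m"
    using s c(2) froot by (auto simp: t_def)
  ultimately show ?case
    by (intro exI [of _ t]) simp
qed

lemma Re_csqrt_pos:
  assumes "Re z > 0"
  shows "Re (csqrt z) > 0"
proof -
  have "Re z = (Re (csqrt z))\<^sup>2 - (Im (csqrt z))\<^sup>2"
    by (metis Re_power2 power2_csqrt)
  then have "Re (csqrt z) \<noteq> 0"
    using assms zero_le_power2 [of "Im (csqrt z)"] by (auto simp del: csqrt.simps)
  then show ?thesis
    using Re_csqrt [of z] by linarith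
qed

text \<open>For existence take \<open>X = s(S)\<close> with \<open>s\<close> interpolating
  \<open>csqrt\<close>. For uniqueness, a second root \<open>Y\<close> commutes with
  \<open>S\<close>, hence with the polynomial \<open>X\<close> in \<open>S\<close>, so
  \<open>(X + Y) (Y - X) = 0\<close>; it remains to see that \<open>Y - X\<close> vanishes both on
  the range and on the kernel of \<open>S\<close>.\<close>

lemma matrix_sqrt_ex1:
  fixes S :: "complex^'n^'n"
  assumes S: "eigenvalues S \<subseteq> right_half_plane \<union> {0}" "semisimple_eigenvalue S 0"
  shows "\<exists>!X. X ** X = S \<and> eigenvalues X \<subseteq> right_half_plane \<union> {0} \<and> semisimple_eigenvalue X 0"
proof -
  have ker: "S *v v = 0" if "S *v (S *v v) = 0" for v
    using S(2) that unfolding semisimple_0_iff by blast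
  obtain L where L: "set L \<subseteq> eigenvalues S - {0}" and f: "mat_poly S ([:0, 1:] * root_poly L) = 0"
    using annihilating_list_semisimple [OF S(2)] .
  have L_pos: "Re c > 0" if "c \<in> set L" for c
    using that L S(1) by (auto simp: right_half_plane_def)
  have L0: "0 \<notin> set L"
    using L by auto
  obtain s where s: "[:0, 1:] * root_poly L dvd s * s - [:0, 1:]" "poly s 0 = 0"
    "\<forall>c\<in>set L. poly s c = csqrt c"
    using exists_poly_sqrt_mod [OF L0] by blast
  define X where "X = mat_poly S s"
  have XX: "X ** X = S"
    using mat_poly_eq_if_dvd_diff [OF f s(1)] by (simp add: X_def mat_poly_mult)
  have eigen_X: "X *v v = poly s c *s v" if "S *v v = c *s v" for v c
    using mat_poly_eigenvector [OF that] by (simp add: X_def)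
  have XS: "X ** S = S ** X"
    using mat_poly_commute [of S S s] by (simp add: X_def)
  have ker_X: "X *v v = 0" if "S *v v = 0" for v
    using eigen_X [of v 0] that by (simp add: s(2))
  have "semisimple_eigenvalue X 0"
    unfolding semisimple_0_iff
  proof (intro conjI allI impI)
    show "\<not> invertible X"
      using S(2) invertible_mult [of X X] XX unfolding semisimple_0_iff by auto
    fix v
    assume "X *v (X *v v) = 0"
    then show "X *v v = 0"
      by (intro ker_X) (simp only: XX matrix_vector_mul_assoc)
  qed
  moreover have "eigenvalues X \<subseteq> right_half_plane \<union> {0}"
  proof
    fix m
    assume "m \<in> eigenvalues X"
    then obtain w where w: "w \<noteq> 0" "X *v w = m *s w"
      unfolding eigenvalues_def by auto
    \<comment> \<open>Each eigenspace of \<open>X\<close> is invariant under \<open>S\<close>, so it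
      contains an eigenvector of \<open>S\<close>, for some \<open>c\<close>; there \<open>X\<close>
      acts as \<open>poly s c\<close>.\<close>
    have f0: "mat_poly S (root_poly (0 # L)) *v w = 0"
      using f by (simp only: list.map prod_list.Cons minus_zero matrix_vector_mult_0)
    have inv: "X *v (S *v v - c *s v) = m *s (S *v v - c *s v)" if "X *v v = m *s v" for v c
    proof -
      have "X *v (S *v v) = S *v (X *v v)"
        by (simp only: XS matrix_vector_mul_assoc)
      then show ?thesis
        by (simp add: that matrix_vector_mult_diff_distrib matrix_vector_mult_smult vec_eq_iff algebra_simps)
    qed
    have "\<exists>v c. v \<noteq> 0 \<and> X *v v = m *s v \<and> c \<in> set (0 # L) \<and> S *v v = c *s v"
      by (rule eigenvector_in_invariant_set [where V = "\<lambda>v. X *v v = m *s v", OF f0 w inv])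
    then obtain v c where v: "v \<noteq> 0" "X *v v = m *s v" "c \<in> set (0 # L)" "S *v v = c *s v"
      by (elim exE conjE)
    have "(m - poly s c) *s v = 0"
      using eigen_X [OF v(4)] v(2) by (simp add: vector_sub_rdistrib)
    then have "m = poly s c"
      using v(1) by (simp only: vector_mul_eq_0) simp
    then show "m \<in> right_half_plane \<union> {0}"
      using v(3) s(2,3) L_pos Re_csqrt_pos by (auto simp: right_half_plane_def)
  qed
  moreover have "Y = X" if Y: "Y ** Y = S" "eigenvalues Y \<subseteq> right_half_plane \<union> {0}"
    "semisimple_eigenvalue Y 0" for Y
  proof -
    have "Y ** S = S ** Y"
      by (metis Y(1) matrix_mul_assoc)
    then have YX: "Y ** X = X ** Y"
      unfolding X_def by (rule mat_poly_commute)
    \<comment> \<open>Otherwise the kernel of \<open>X + Y\<close>, invariant under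
      \<open>S\<close>, contains an eigenvector of \<open>S\<close> with nonzero eigenvalue
      \<open>c\<close>. On it \<open>Y = - X\<close>, so \<open>- csqrt c\<close> is an eigenvalue
      of \<open>Y\<close> with negative real part.\<close>
    have sum_ker: "S *v w = 0" if w: "(X + Y) *v w = 0" for w
    proof (rule ccontr)
      assume nz: "S *v w \<noteq> 0"
      have inv: "(X + Y) *v (S *v v) = 0" if "(X + Y) *v v = 0" for v
      proof -
        have "(X + Y) ** S = S ** (X + Y)"
          by (simp only: matrix_add_ldistrib matrix_add_rdistrib XS \<open>Y ** S = S ** Y\<close>)
        then have "(X + Y) *v (S *v v) = S *v ((X + Y) *v v)"
          by (simp only: matrix_vector_mul_assoc)
        then show ?thesis
          unfolding that by simp
      qed
      then have inv': "(X + Y) *v (S *v v - c *s v) = 0" if "(X + Y) *v v = 0" for v c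
        using that by (simp add: matrix_vector_mult_diff_distrib matrix_vector_mult_smult)
      have "mat_poly S (root_poly L) *v (S *v w) = mat_poly S (root_poly L * [:0, 1:]) *v w"
        by (simp add: mat_poly_mult matrix_vector_mul_assoc del: mult_pCons_right mult_pCons_left)
      also have "\<dots> = 0"
        using f by (simp only: mult.commute matrix_vector_mult_0)
      finally have *: "mat_poly S (root_poly L) *v (S *v w) = 0" .
      have "\<exists>v c. v \<noteq> 0 \<and> (X + Y) *v v = 0 \<and> c \<in> set L \<and> S *v v = c *s v"
        by (rule eigenvector_in_invariant_set [where V = "\<lambda>v. (X + Y) *v v = 0", OF * nz inv [OF w] inv'])
      then obtain v c where v: "v \<noteq> 0" "(X + Y) *v v = 0" "c \<in> set L" "S *v v = c *s v"
        by (elim exE conjE)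
      have "Y *v v = - (X *v v)"
        using v(2) by (simp add: matrix_vector_mult_add_rdistrib eq_neg_iff_add_eq_0 add.commute)
      also have "\<dots> = (- csqrt c) *s v"
        using eigen_X [OF v(4)] s(3) v(3) by (simp add: vec_eq_iff)
      finally have "- csqrt c \<in> eigenvalues Y"
        using v(1) unfolding eigenvalues_def by blast
      then have "- csqrt c \<in> right_half_plane \<union> {0}"
        using Y(2) by blast
      then show False
        using Re_csqrt_pos [OF L_pos [OF v(3)]] by (auto simp: right_half_plane_def)
    qed
    define D where "D = Y - X"
    have "(X + Y) ** D = 0"
      by (simp add: D_def matrix_add_rdistrib matrix_diff_ldistrib YX Y(1) XX)
    then have SD: "S ** D = 0"
      using sum_ker by (simp add: matrix_eq matrix_vector_mul_assoc [symmetric])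
    have DS: "D ** S = 0"
      using SD by (simp add: D_def matrix_diff_ldistrib matrix_diff_rdistrib XS \<open>Y ** S = S ** Y\<close>)
    have ker_D: "D *v v = 0" if "S *v v = 0" for v
    proof -
      have "Y *v (Y *v v) = 0"
        using that Y(1) by (simp add: matrix_vector_mul_assoc)
      then have "Y *v v = 0"
        using Y(3) unfolding semisimple_0_iff by blast
      then show ?thesis
        using ker_X [OF that] by (simp add: D_def matrix_vector_mult_diff_rdistrib)
    qed
    have "D *v v = 0" for v
    proof -
      \<comment> \<open>Up to the nonzero scalar \<open>poly g 0\<close>, \<open>v\<close> is split
        into \<open>u\<close> in the kernel of \<open>S\<close> and a vector in its range.\<close>
      define g where "g = root_poly L"
      have g0: "poly g 0 \<noteq> 0"
        using L0 by (simp add: g_def poly_root_poly_eq_0_iff)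
      obtain h where h: "[:poly g 0:] - g = [:0, 1:] * h"
        using poly_eq_0_iff_dvd [of "[:poly g 0:] - g" 0] by (auto elim: dvdE)
      define u where "u = mat_poly S g *v v"
      have "S *v u = mat_poly S ([:0, 1:] * g) *v v"
        by (simp only: u_def mat_poly_mult matrix_vector_mul_assoc) simp
      then have "D *v u = 0"
        using f by (intro ker_D) (simp only: g_def matrix_vector_mult_0)
      moreover have "poly g 0 *s v - u = S *v (mat_poly S h *v v)"
      proof -
        have "poly g 0 *s v - u = mat_poly S ([:poly g 0:] - g) *v v"
          by (simp add: u_def mat_poly_diff matrix_vector_mult_diff_rdistrib mat_mult_vector)
        then show ?thesis
          unfolding h by (simp add: mat_poly_mult matrix_vector_mul_assoc del: mult_pCons_left)
      qed
      then have "D *v (poly g 0 *s v - u) = (D ** S) *v (mat_poly S h *v v)"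
        by (simp only: matrix_vector_mul_assoc matrix_mul_assoc)
      then have "D *v (poly g 0 *s v - u) = 0"
        by (simp add: DS)
      ultimately have "poly g 0 *s (D *v v) = 0"
        by (simp add: matrix_vector_mult_diff_distrib matrix_vector_mult_smult)
      then show ?thesis
        using g0 by simp
    qed
    then have "D = 0"
      by (simp add: matrix_eq)
    then show ?thesis
      by (simp add: D_def)
  qed
  ultimately show ?thesis
    using XX by blast
qed

lemma
  fixes S :: "complex^'n^'n"
  assumes "eigenvalues S \<subseteq> right_half_plane \<union> {0}" "semisimple_eigenvalue S 0"
  shows matrix_sqrt_square: "matrix_sqrt S ** matrix_sqrt S = S"
    and eigenvalues_matrix_sqrt: "eigenvalues (matrix_sqrt S) \<subseteq> right_half_plane \<union> {0}"
    and semisimple_matrix_sqrt: "semisimple_eigenvalue (matrix_sqrt S) 0"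
  using theI' [OF matrix_sqrt_ex1 [OF assms]] unfolding matrix_sqrt_def by simp_all

section \<open>Closed form of the iterates\<close>

lemma smult_two: "smult 2 p = p + (p :: 'a::comm_ring_1 poly)"
  using smult_add_left [of 1 1 p] by (simp only: one_add_one smult_1_left)

text \<open>The inverse is lifted root by root: adding \<open>c\<close> times the old modulus to
  \<open>q\<close> keeps the old congruence, and as \<open>p\<close> is nonzero at \<open>m\<close>,
  \<open>c\<close> can be chosen to gain the factor for \<open>m\<close>.\<close>

lemma exists_poly_inverse_mod:
  assumes "\<forall>c\<in>set L. poly p c \<noteq> 0"
  shows "\<exists>q. root_poly L dvd p * q - 1"
  using assms
proof (induction L)
  case Nil
  show ?case
    by simp
next
  case (Cons m L)
  then obtain q h where h: "p * q - 1 = root_poly L * h"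
    by (auto elim: dvdE)
  define c where "c = - poly h m / poly p m"
  have "p * (q + smult c (root_poly L)) - 1 = (p * q - 1) + root_poly L * smult c p"
    by (simp add: algebra_simps)
  also have "\<dots> = root_poly L * (h + smult c p)"
    by (simp only: h ring_distribs)
  finally have "p * (q + smult c (root_poly L)) - 1 = root_poly L * (h + smult c p)" .
  moreover have "poly (h + smult c p) m = 0"
    using Cons.prems by (simp add: c_def)
  then have "[:- m, 1:] dvd h + smult c p"
    by (simp only: poly_eq_0_iff_dvd)
  ultimately have "root_poly L * [:- m, 1:] dvd p * (q + smult c (root_poly L)) - 1"
    by (simp only: mult_dvd_mono dvd_refl)
  then show ?case
    by (intro exI [of _ "q + smult c (root_poly L)"]) (simp only: list.map prod_list.Cons mult.commute)
qed

lemma mult_matrix_inv_eq: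
  fixes T W R :: "complex^'n^'n"
  assumes "T ** W = R" "invertible W"
  shows "R ** matrix_inv W = T"
proof -
  have "W ** matrix_inv W = mat 1"
    using assms(2) unfolding invertible_def matrix_inv_def by (rule someI2_ex) blast
  then show ?thesis
    using assms(1) by (metis matrix_mul_assoc matrix_mul_rid)
qed

text \<open>The Cayley transform \<open>(g - c) / (g + c)\<close> maps the open right half plane
  into the open unit disc.\<close>

lemma cmod_diff_less_cmod_add:
  assumes "g > 0" "Re c > 0"
  shows "cmod (of_real g - c) < cmod (of_real g + c)"
proof -
  have "(g - Re c)\<^sup>2 < (g + Re c)\<^sup>2"
    using assms by (simp add: power2_eq_square algebra_simps)
  then show ?thesis
    by (simp add: cmod_def)
qed

locale singular_root =
  fixes X :: "complex^'n^'n" and L :: "complex list" and \<gamma> :: real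
  assumes annihilates: "mat_poly X (root_poly (0 # L)) = 0"
    and roots_pos: "c \<in> set L \<Longrightarrow> Re c > 0"
    and singular: "\<not> invertible X"
    and gamma_pos: "\<gamma> > 0"
begin

abbreviation E :: "complex poly \<Rightarrow> complex^'n^'n" where "E \<equiv> mat_poly X"

abbreviation x :: "complex poly" where "x \<equiv> [:0, 1:]"

lemma E_x: "E x = X"
  by simp

text \<open>\<open>E p = E q\<close> is treated as a congruence of polynomials. Terms can then be
  rearranged in a commutative ring, while facts valid only after evaluation are substituted by the
  rules \<open>E_cong\<close>.\<close>

lemma E_cong_mult: "E p = E p' \<Longrightarrow> E q = E q' \<Longrightarrow> E (p * q) = E (p' * q')"
  by (simp only: mat_poly_mult)

lemma E_cong_add: "E p = E p' \<Longrightarrow> E q = E q' \<Longrightarrow> E (p + q) = E (p' + q')"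
  by (simp only: mat_poly_add)

lemma E_cong_smult: "E p = E p' \<Longrightarrow> E (smult c p) = E (smult c p')"
  by (simp only: mat_poly_smult)

lemma E_cong_diff: "E p = E p' \<Longrightarrow> E q = E q' \<Longrightarrow> E (p - q) = E (p' - q')"
  by (simp only: mat_poly_diff)

lemmas E_cong = E_cong_mult E_cong_add E_cong_diff E_cong_smult

lemma E_inverse:
  assumes "poly p 0 \<noteq> 0" "\<And>c. c \<in> set L \<Longrightarrow> poly p c \<noteq> 0"
  obtains q where "E (p * q) = E 1"
proof -
  have "\<exists>q. root_poly (0 # L) dvd p * q - 1"
    by (rule exists_poly_inverse_mod) (use assms in simp)
  then show thesis
    using that mat_poly_eq_if_dvd_diff [OF annihilates] by blast
qed

lemma E_cancel:
  assumes "E (p * q) = E 1" "E (p * r) = E (p * s)"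
  shows "E r = E s"
proof -
  have "E (1 * r) = E (p * q * r)" "E (1 * s) = E (p * q * s)"
    by (rule E_cong_mult [OF assms(1) [symmetric] refl])+
  moreover have "E (q * (p * r)) = E (q * (p * s))"
    by (rule E_cong_mult [OF refl assms(2)])
  ultimately show ?thesis
    by (simp only: mult_1 mult_ac)
qed

section \<open>The closed form as a quotient of polynomials\<close>

definition al :: "complex poly" where "al = [:of_real \<gamma>, 1:]"

definition be :: "complex poly" where "be = [:of_real \<gamma>, - 1:]"

definition num :: "nat \<Rightarrow> complex poly" where "num m = al ^ m + be ^ m"

text \<open>This is \<open>(al^m - be^m) / x\<close>, a geometric sum because
  \<open>al - be = 2 x\<close>. With \<open>x\<close> divided out the denominator becomes a unit for
  \<open>m > 0\<close>, although \<open>X\<close> is singular.\<close>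

definition den :: "nat \<Rightarrow> complex poly" where
  "den m = smult 2 (\<Sum>i<m. be ^ (m - Suc i) * al ^ i)"

lemma x_mult_den: "x * den m = al ^ m - be ^ m"
proof -
  have "al ^ m - be ^ m = (al - be) * (\<Sum>i<m. be ^ (m - Suc i) * al ^ i)"
    by (rule power_diff_sumr2)
  also have "al - be = smult 2 x"
    by (simp add: al_def be_def)
  finally show ?thesis
    by (simp only: den_def mult_smult_left mult_smult_right)
qed

text \<open>At 0 both \<open>al\<close> and \<open>be\<close> equal \<open>\<gamma>\<close>, so all
  \<open>m\<close> summands agree. The factor \<open>m\<close> causes the slow rate.\<close>

lemma poly_den_0: "poly (den m) 0 = 2 * of_nat m * of_real \<gamma> ^ (m - 1)"
proof -
  have "(of_real \<gamma> :: complex) ^ (m - Suc i) * of_real \<gamma> ^ i = of_real \<gamma> ^ (m - 1)" if "i < m" for i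
    using that by (simp flip: power_add)
  then show ?thesis
    by (simp add: den_def poly_sum al_def be_def)
qed

lemma poly_den_nz:
  assumes "m > 0" "c \<in> set L"
  shows "poly (den m) c \<noteq> 0"
proof
  assume "poly (den m) c = 0"
  then have "poly (al ^ m - be ^ m) c = 0"
    by (simp only: x_mult_den [symmetric] poly_mult mult_zero_right)
  then have "(of_real \<gamma> + c) ^ m = (of_real \<gamma> - c) ^ m"
    by (simp add: al_def be_def)
  then have "cmod (of_real \<gamma> + c) ^ m = cmod (of_real \<gamma> - c) ^ m"
    by (simp only: norm_power [symmetric])
  then have "cmod (of_real \<gamma> + c) = cmod (of_real \<gamma> - c)"
    by (rule power_eq_imp_eq_base) (use assms(1) in simp_all)
  then show False
    using cmod_diff_less_cmod_add [OF gamma_pos roots_pos [OF assms(2)]] by simp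
qed

definition den_inv :: "nat \<Rightarrow> complex poly" where
  "den_inv m = (SOME q. E (den m * q) = E 1)"

lemma den_inv: "m > 0 \<Longrightarrow> E (den m * den_inv m) = E 1"
  unfolding den_inv_def
  by (rule someI_ex, rule E_inverse [of "den m"]) (use gamma_pos in \<open>auto simp: poly_den_0 poly_den_nz\<close>)

definition quot :: "nat \<Rightarrow> complex poly" where "quot m = num m * den_inv m"

definition Q :: "nat \<Rightarrow> complex^'n^'n" where "Q m = E (quot m)"

lemma quot_den: "m > 0 \<Longrightarrow> E (quot m * den m) = E (num m)"
  using E_cong_mult [OF refl den_inv, of m "num m"] by (simp only: quot_def mult_ac mult_1_left)

text \<open>The addition formulas of the hyperbolic cotangent, which \<open>num m / den m\<close> is up to scaling.\<close>

lemma num_den_add: "num k * den m + num m * den k = smult 2 (den (k + m))"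
proof -
  \<comment> \<open>The factor \<open>x\<close> makes \<open>x_mult_den\<close> applicable and is
    cancelled at the end, among polynomials and not after evaluation.\<close>
  have "x * (num k * den m + num m * den k) = num k * (x * den m) + num m * (x * den k)"
    by (simp only: ring_distribs mult_ac)
  also have "\<dots> = (al ^ (k + m) - be ^ (k + m)) + (al ^ (k + m) - be ^ (k + m))"
    unfolding x_mult_den num_def by (simp add: algebra_simps power_add)
  also have "\<dots> = x * smult 2 (den (k + m))"
    by (simp only: smult_two distrib_left x_mult_den)
  finally show ?thesis
    by (rule mult_left_cancel [where c = x, THEN iffD1, rotated]) simp
qed

lemma num_den_mult: "x * x * (den k * den m) + num k * num m = smult 2 (num (k + m))"
proof -
  have "x * x * (den k * den m) = (x * den k) * (x * den m)"
    by (simp only: mult_ac)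
  also have "\<dots> + num k * num m = al ^ (k + m) + al ^ (k + m) + (be ^ (k + m) + be ^ (k + m))"
    unfolding x_mult_den num_def by (simp add: algebra_simps power_add)
  also have "\<dots> = smult 2 (num (k + m))"
    by (simp add: num_def smult_two algebra_simps)
  finally show ?thesis .
qed

text \<open>With \<open>Q k = num k / den k\<close>, the addition formulas give
  \<open>2 num (k + m) / (den k den m)\<close> for the left factor and
  \<open>2 den (k + m) / (den k den m)\<close> for the sum to be inverted, which is thus a
  unit.\<close>

lemma Q_add:
  assumes "k > 0" "m > 0"
  shows "(X ** X + Q k ** Q m) ** matrix_inv (Q k + Q m) = Q (k + m)"
proof (rule mult_matrix_inv_eq)
  note qk = quot_den [OF assms(1)] and qm = quot_den [OF assms(2)]
  have sum_den: "E ((quot k + quot m) * (den k * den m)) = E (smult 2 (den (k + m)))"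
  proof -
    have "(quot k + quot m) * (den k * den m) = quot k * den k * den m + quot m * den m * den k"
      by (simp only: ring_distribs mult_ac)
    also have "E \<dots> = E (num k * den m + num m * den k)"
      by (intro E_cong qk qm refl)
    finally show ?thesis
      by (simp only: num_den_add)
  qed
  have "E ((quot k + quot m) * (den k * den m * smult (1 / 2) (den_inv (k + m)))) =
      E ((quot k + quot m) * (den k * den m) * smult (1 / 2) (den_inv (k + m)))"
    by (simp only: mult.assoc)
  also have "\<dots> = E (smult 2 (den (k + m)) * smult (1 / 2) (den_inv (k + m)))"
    by (rule E_cong_mult [OF sum_den refl])
  also have "\<dots> = E (den (k + m) * den_inv (k + m))"
    by (simp add: mat_poly_smult)
  also have "\<dots> = E 1"
    using assms by (intro den_inv) simp
  finally show "invertible (Q k + Q m)"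
    unfolding invertible_right_inverse Q_def mat_poly_add [symmetric]
    by (subst (asm) mat_poly_mult) (auto simp only: mat_poly_1)
  \<comment> \<open>\<open>W\<close> clears all three denominators, and \<open>V\<close> is its
    inverse under \<open>E\<close>.\<close>
  define W where "W = den k * den m * den (k + m)"
  define V where "V = den_inv k * den_inv m * den_inv (k + m)"
  have "W * V = (den k * den_inv k) * (den m * den_inv m) * (den (k + m) * den_inv (k + m))"
    by (simp only: W_def V_def mult_ac)
  also have "E \<dots> = E (1 * 1 * 1)"
    by (intro E_cong den_inv) (use assms in simp_all)
  finally have WV: "E (W * V) = E 1"
    by simp
  have "W * (quot (k + m) * (quot k + quot m)) =
      (quot (k + m) * den (k + m)) * ((quot k + quot m) * (den k * den m))"
    by (simp only: W_def mult_ac)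
  also have "E \<dots> = E (num (k + m) * smult 2 (den (k + m)))"
    by (intro E_cong_mult sum_den quot_den) (use assms in simp)
  also have "num (k + m) * smult 2 (den (k + m)) = (x * x * (den k * den m) + num k * num m) * den (k + m)"
    by (simp only: num_den_mult mult_smult_left mult_smult_right)
  also have "E \<dots> = E ((x * x * (den k * den m) + (quot k * den k) * (quot m * den m)) * den (k + m))"
    by (intro E_cong qk [symmetric] qm [symmetric] refl)
  also have "(x * x * (den k * den m) + (quot k * den k) * (quot m * den m)) * den (k + m) =
      W * (x * x + quot k * quot m)"
    by (simp only: W_def ring_distribs mult_ac)
  finally have "E (quot (k + m) * (quot k + quot m)) = E (x * x + quot k * quot m)"
    by (rule E_cancel [OF WV])
  then show "Q (k + m) ** (Q k + Q m) = X ** X + Q k ** Q m"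
    by (simp only: Q_def mat_poly_add mat_poly_mult E_x)
qed

section \<open>Identification of the iterations with the closed form\<close>

lemma Q_1: "Q (Suc 0) = \<gamma> *\<^sub>R mat 1"
proof -
  have "quot (Suc 0) = smult (of_real \<gamma>) (den (Suc 0) * den_inv (Suc 0))"
    by (simp add: quot_def num_def den_def al_def be_def mult.commute)
  then have "Q (Suc 0) = E (smult (of_real \<gamma>) 1)"
    unfolding Q_def by (simp only: E_cong_smult [OF den_inv [OF zero_less_Suc]])
  then show ?thesis
    by (simp only: mat_poly_smult scaleR_eq_mat mat_poly_1)
qed

text \<open>As \<open>Q 1\<close> is \<open>\<gamma>\<close> times the identity, a basic step is an
  addition of indices with one of them equal to 1.\<close>

lemma basic_iter_eq: "basic_iter \<gamma> (X ** X) (Suc k) = Q (Suc k)"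
proof (induction k)
  case 0
  then show ?case
    by (simp add: Q_1)
next
  case (Suc k)
  have "\<gamma> *\<^sub>R Q (Suc k) = Q (Suc 0) ** Q (Suc k)"
    by (simp only: Q_1 scaleR_eq_mat matrix_mul_rid)
  then show ?case
    using Q_add [of "Suc 0" "Suc k"] by (simp add: Suc Q_1 add.commute)
qed

lemma inner_iter_eq:
  assumes "m > 0"
  shows "inner_iter (X ** X) (Q m) (Suc l) = Q (Suc l * m)"
proof (induction l)
  case (Suc l)
  then show ?case
    using Q_add [of m "Suc l * m"] assms by simp
qed simp

lemma order_iter_eq:
  assumes "r > 1"
  shows "order_iter r \<gamma> (X ** X) (Suc k) = Q (r ^ k)"
proof (induction k)
  case 0
  then show ?case
    by (simp add: Q_1)
next
  case (Suc k)
  \<comment> \<open>The inner index \<open>r - 1 = Suc l\<close> yields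
    \<open>Q (Suc l * r ^ k)\<close>; the final step adds one more \<open>r ^ k\<close>. For
    \<open>r = 2\<close> the inner loop is empty.\<close>
  obtain l where l: "r = Suc (Suc l)"
    using less_imp_Suc_add [OF assms] by auto
  have "r ^ k + Suc l * r ^ k = r ^ Suc k"
    by (simp add: l)
  then have "(X ** X + Q (r ^ k) ** Q (Suc l * r ^ k)) ** matrix_inv (Q (r ^ k) + Q (Suc l * r ^ k)) = Q (r ^ Suc k)"
    using Q_add [of "r ^ k" "Suc l * r ^ k"] assms by simp
  moreover have "inner_iter (X ** X) (Q (r ^ k)) (r - 1) = Q (Suc l * r ^ k)"
    using inner_iter_eq [of "r ^ k" l] assms by (simp add: l)
  ultimately show ?case
    by (simp only: order_iter.simps Let_def Suc)
qed

end

section \<open>Asymptotics of the closed form\<close>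

lemma matrix_mult_norm_bound:
  "\<exists>K>0. \<forall>(A :: complex^'n^'n) (B :: complex^'n^'n). norm (A ** B) \<le> norm A * norm B * K"
proof -
  have "bilinear ((**) :: complex^'n^'n \<Rightarrow> complex^'n^'n \<Rightarrow> complex^'n^'n)"
    unfolding bilinear_def
    by (auto intro!: linearI simp: vec_eq_iff matrix_matrix_mult_def
        scaleR_sum_right sum.distrib ring_distribs)
  then have "bounded_bilinear ((**) :: complex^'n^'n \<Rightarrow> complex^'n^'n \<Rightarrow> complex^'n^'n)"
    by (simp only: bilinear_conv_bounded_bilinear)
  then show ?thesis
    by (rule bounded_bilinear.pos_bounded)
qed

lemma norm_mat_mult: "norm (mat c ** A) = cmod c * norm (A :: complex^'n^'n)"
proof -
  have "norm ((mat c ** A) $ i) = cmod c * norm (A $ i)" for i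
    by (simp add: norm_vec_def mat_mult_component norm_mult L2_set_right_distrib)
  then show ?thesis
    by (simp add: norm_vec_def L2_set_right_distrib)
qed

text \<open>\<open>\<sigma>\<close> lies strictly between \<open>max q \<rho>\<close> and 1, which
  avoids a factor \<open>k\<close> when \<open>q = \<rho>\<close>. \<open>C\<close> is large enough
  for \<open>q C + K \<le> C \<sigma>\<close>.\<close>

lemma geometric_recurrence_bound:
  fixes u :: "nat \<Rightarrow> real"
  assumes u: "\<And>k. u (Suc k) \<le> q * u k + K * \<rho> ^ k"
    and "0 \<le> q" "q < 1" "0 \<le> \<rho>" "\<rho> < 1" "0 \<le> K" "\<And>k. 0 \<le> u k"
  obtains C \<sigma> where "0 \<le> \<sigma>" "\<sigma> < 1" "\<And>k. u k \<le> C * \<sigma> ^ k"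
proof -
  define \<sigma> where "\<sigma> = (1 + max q \<rho>) / 2"
  have \<sigma>: "q < \<sigma>" "\<rho> \<le> \<sigma>" "0 \<le> \<sigma>" "\<sigma> < 1"
    using assms by (auto simp: \<sigma>_def max_def)
  define C where "C = u 0 + K / (\<sigma> - q)"
  have KC: "K \<le> C * (\<sigma> - q)"
    using \<sigma>(1) assms(7) [of 0] by (simp add: C_def distrib_right)
  have bound: "u k \<le> C * \<sigma> ^ k" for k
  proof (induction k)
    case 0
    then show ?case
      using \<sigma> assms by (simp add: C_def)
  next
    case (Suc k)
    have "u (Suc k) \<le> q * (C * \<sigma> ^ k) + K * \<sigma> ^ k"
      using u [of k] mult_left_mono [OF Suc \<open>0 \<le> q\<close>]
        mult_left_mono [OF power_mono [OF \<sigma>(2) \<open>0 \<le> \<rho>\<close>, of k] \<open>0 \<le> K\<close>] by linarith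
    also have "\<dots> \<le> q * (C * \<sigma> ^ k) + C * (\<sigma> - q) * \<sigma> ^ k"
      using mult_right_mono [OF KC, of "\<sigma> ^ k"] \<sigma>(3) by simp
    also have "\<dots> = C * \<sigma> ^ Suc k"
      by (simp add: algebra_simps)
    finally show ?case .
  qed
  show thesis
    by (rule that [OF \<sigma>(3,4) bound])
qed

context singular_root
begin

lemma E_root_0: "E (x * root_poly L) = 0"
  using annihilates by (simp only: list.map prod_list.Cons minus_zero)

text \<open>The error is \<open>2 be^m / den m\<close>, because
  \<open>num m - x den m = 2 be^m\<close>.\<close>

lemma quot_diff_den: "m > 0 \<Longrightarrow> E ((quot m - x) * den m) = E (smult 2 (be ^ m))"
proof -
  assume m: "m > 0"
  have "(quot m - x) * den m = quot m * den m - x * den m"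
    by (simp only: left_diff_distrib)
  also have "E \<dots> = E (num m - (al ^ m - be ^ m))"
    by (intro E_cong quot_den m) (simp only: x_mult_den)
  also have "num m - (al ^ m - be ^ m) = smult 2 (be ^ m)"
    by (simp only: num_def smult_two) simp
  finally show ?thesis .
qed

text \<open>\<open>c\<close> stands for \<open>be / al\<close>. Were \<open>p\<close> an eigenvector
  for \<open>z\<close>, \<open>c\<close> would scale it by \<open>b / a\<close>, of modulus below 1;
  in general the deviation is governed by \<open>p'\<close>, which has one annihilating factor less
  and decays by induction.\<close>

lemma cayley_decay:
  assumes c: "E (al * c) = E be"
    and "\<And>z. z \<in> set R \<Longrightarrow> Re z > 0" "E (root_poly R * p) = 0"
  shows "\<exists>K \<rho>. 0 \<le> \<rho> \<and> \<rho> < 1 \<and> (\<forall>k. norm (E (c ^ k * p)) \<le> K * \<rho> ^ k)"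
  using assms(2-)
proof (induction R arbitrary: p)
  case Nil
  then have "E (c ^ k * p) = 0" for k
    by (simp add: mat_poly_mult)
  then show ?case
    by (intro exI [of _ 0]) simp
next
  case (Cons z R)
  define p' where "p' = [:- z, 1:] * p"
  have "E (root_poly R * p') = 0"
    using Cons.prems(2) by (simp only: p'_def list.map prod_list.Cons mult_ac)
  then obtain K \<rho> where K: "0 \<le> \<rho>" "\<rho> < 1" "\<And>k. norm (E (c ^ k * p')) \<le> K * \<rho> ^ k"
    using Cons.IH [of p'] Cons.prems(1) by auto
  define a b :: complex where "a = of_real \<gamma> + z" and "b = of_real \<gamma> - z"
  have ba: "cmod b < cmod a"
    unfolding a_def b_def by (rule cmod_diff_less_cmod_add [OF gamma_pos]) (simp add: Cons.prems(1))
  have K0: "0 \<le> K"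
    using order_trans [OF norm_ge_zero K(3) [of 0]] by simp
  have step: "norm (E (c ^ Suc k * p)) \<le> cmod b / cmod a * norm (E (c ^ k * p)) + 2 * K / cmod a * \<rho> ^ k" for k
  proof -
    \<comment> \<open>Together with \<open>al c = be\<close> these give
      \<open>a c^(k+1) p = b c^k p - c^k p' - c^(k+1) p'\<close>; the last two terms account for
      \<open>2 K\<close>.\<close>
    have ab: "smult a p = al * p - p'" "smult b p = be * p + p'"
      by (simp_all add: a_def b_def al_def be_def p'_def algebra_simps smult_add_left smult_diff_left)
    have "smult a (c ^ Suc k * p) = c ^ Suc k * (al * p - p')"
      by (simp only: ab(1) [symmetric] mult_smult_right)
    moreover have "smult b (c ^ k * p) = c ^ k * (be * p + p')"
      by (simp only: ab(2) [symmetric] mult_smult_right)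
    ultimately have "smult a (c ^ Suc k * p) = al * c * (c ^ k * p) - c ^ Suc k * p'"
      "smult b (c ^ k * p) = be * (c ^ k * p) + c ^ k * p'"
      by (simp_all only: distrib_left right_diff_distrib power_Suc mult_ac)
    then have "E (smult a (c ^ Suc k * p)) = E (smult b (c ^ k * p)) - E (c ^ k * p') - E (c ^ Suc k * p')"
      using E_cong_mult [OF c refl, of "c ^ k * p"] by (simp only: mat_poly_diff mat_poly_add) simp
    then have "cmod a * norm (E (c ^ Suc k * p)) =
        norm (E (smult b (c ^ k * p)) - E (c ^ k * p') - E (c ^ Suc k * p'))"
      by (simp only: mat_poly_smult norm_mat_mult [symmetric])
    also have "\<dots> \<le> norm (E (smult b (c ^ k * p))) + norm (E (c ^ k * p')) + norm (E (c ^ Suc k * p'))"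
      by (intro order_trans [OF norm_triangle_ineq4] add_mono order_refl)
    also have "\<dots> \<le> cmod b * norm (E (c ^ k * p)) + K * \<rho> ^ k + K * \<rho> ^ Suc k"
      using K(3) by (intro add_mono) (simp_all only: mat_poly_smult norm_mat_mult order_refl)
    also have "K * \<rho> ^ Suc k \<le> K * \<rho> ^ k"
      using K K0 by (intro mult_left_mono power_decreasing) simp_all
    finally have "cmod a * norm (E (c ^ Suc k * p)) \<le> cmod b * norm (E (c ^ k * p)) + 2 * K * \<rho> ^ k"
      by simp
    then show ?thesis
      using ba le_less_trans [OF norm_ge_zero ba] by (simp add: field_simps)
  qed
  have "0 \<le> cmod b / cmod a" "cmod b / cmod a < 1" "0 \<le> 2 * K / cmod a"
    using ba K0 le_less_trans [OF norm_ge_zero ba] by simp_all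
  then show ?case
    using geometric_recurrence_bound [OF step _ _ K(1,2)] norm_ge_zero by (metis (no_types, lifting))
qed

text \<open>Scaled to the value 1 at 0, so that \<open>E proj\<close> is the spectral projection
  onto the kernel of \<open>X\<close>.\<close>

definition proj :: "complex poly" where
  "proj = smult (1 / poly (root_poly L) 0) (root_poly L)"

lemma poly_proj_0: "poly proj 0 = 1"
proof -
  have "0 \<notin> set L"
    using roots_pos by fastforce
  then show ?thesis
    by (simp add: proj_def poly_root_poly_eq_0_iff)
qed

lemma E_x_proj: "E (x * proj) = 0"
  unfolding proj_def mult_smult_right mat_poly_smult E_root_0 by simp

text \<open>\<open>p\<close> differs from its value at 0 by a multiple of \<open>x\<close>, and
  \<open>x * proj\<close> evaluates to 0.\<close>

lemma E_mult_proj: "E (p * proj) = E (smult (poly p 0) proj)"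
proof -
  obtain h where "p - [:poly p 0:] = x * h"
    using poly_eq_0_iff_dvd [of "p - [:poly p 0:]" 0] by (auto elim: dvdE)
  moreover have "p * proj - smult (poly p 0) proj = (p - [:poly p 0:]) * proj"
    by (simp add: left_diff_distrib)
  ultimately have "p * proj - smult (poly p 0) proj = h * (x * proj)"
    by (simp only: mult_ac)
  then have "E (p * proj - smult (poly p 0) proj) = 0"
    by (simp only: mat_poly_mult [of X h] E_x_proj times0_right)
  then show ?thesis
    by (simp only: mat_poly_diff right_minus_eq)
qed

text \<open>Singularity of \<open>X\<close> enters here: a nonzero kernel vector is fixed by
  \<open>E proj\<close>. A zero limit of the scaled errors would determine no rate.\<close>

lemma proj_nonzero: "E proj \<noteq> 0"
proof
  assume "E proj = 0"
  obtain v where v: "v \<noteq> 0" "X *v v = 0"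
    using singular unfolding invertible_left_inverse matrix_left_invertible_ker by blast
  then have "E proj *v v = v"
    using mat_poly_eigenvector [of X v 0 proj] by (simp add: poly_proj_0)
  then show False
    using v(1) \<open>E proj = 0\<close> by simp
qed

text \<open>Against \<open>proj\<close> only values at 0 count: \<open>2 m \<gamma>^(m-1)\<close>
  for \<open>den m\<close> and \<open>2 \<gamma>^m\<close> for the product of the error with
  \<open>den m\<close>.\<close>

lemma error_proj:
  assumes "m > 0"
  shows "real m *\<^sub>R E ((quot m - x) * proj) = \<gamma> *\<^sub>R E proj"
proof -
  define e where "e = (quot m - x) * proj"
  have "smult (poly (den m) 0) e = (quot m - x) * smult (poly (den m) 0) proj"
    by (simp only: e_def mult_smult_right)
  also have "E \<dots> = E ((quot m - x) * (den m * proj))"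
    by (rule E_cong_mult [OF refl E_mult_proj [symmetric]])
  also have "\<dots> = E (((quot m - x) * den m) * proj)"
    by (simp only: mult.assoc)
  also have "\<dots> = E (smult 2 (be ^ m) * proj)"
    by (rule E_cong_mult [OF quot_diff_den [OF assms] refl])
  also have "\<dots> = E (smult (2 * of_real \<gamma> ^ m) proj)"
    unfolding E_mult_proj by (simp add: be_def)
  finally have "mat (2 * of_nat m * of_real \<gamma> ^ (m - 1)) ** E e = mat (2 * of_real \<gamma> ^ m) ** E proj"
    by (simp only: mat_poly_smult poly_den_0)
  then have "(mat (2 * of_nat m * of_real \<gamma> ^ (m - 1)) ** E e) $ i $ j = (mat (2 * of_real \<gamma> ^ m) ** E proj) $ i $ j" for i j
    by (simp only:)
  then have "2 * of_nat m * of_real \<gamma> ^ (m - 1) * E e $ i $ j = 2 * of_real \<gamma> ^ m * E proj $ i $ j" for i j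
    by (simp only: mat_mult_component)
  moreover have "(of_real \<gamma> :: complex) ^ m = of_real \<gamma> ^ (m - 1) * of_real \<gamma>"
    using assms by (rule power_minus_mult [symmetric])
  ultimately have "of_nat m * E e $ i $ j = of_real \<gamma> * E proj $ i $ j" for i j
    using gamma_pos by simp
  then show ?thesis
    by (simp add: vec_eq_iff e_def scaleR_conv_of_real [where 'a = complex])
qed

lemma al_invertible: "\<exists>q. E (al * q) = E 1"
proof (rule E_inverse [of al])
  show "poly al 0 \<noteq> 0"
    using gamma_pos by (simp add: al_def)
  show "poly al z \<noteq> 0" if "z \<in> set L" for z
    using cmod_diff_less_cmod_add [OF gamma_pos roots_pos [OF that]]
    by (auto simp: al_def)
qed blast

text \<open>From \<open>x den m = al^m (1 - c^m)\<close> the error \<open>e\<close> satisfies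
  \<open>e (1 - c^m) = 2 x c^m\<close> on the complement. The relation is left as a fixed-point
  equation for \<open>e\<close>, so that \<open>1 - c^m\<close> need not be inverted.\<close>

lemma error_complement:
  assumes c: "E (al * c) = E be" and "m > 0"
  shows "E ((quot m - x) * (1 - proj)) =
    E ((quot m - x) * (1 - proj)) ** E (c ^ m * (1 - proj)) + mat 2 ** X ** E (c ^ m * (1 - proj))"
proof -
  obtain h where h: "1 - proj = x * h"
    using poly_eq_0_iff_dvd [of "1 - proj" 0] poly_proj_0 by (auto elim: dvdE)
  define e where "e = quot m - x"
  have cm: "E (al ^ m * c ^ m) = E (be ^ m)"
    by (induction m) (simp, simp only: power_Suc, metis (no_types, opaque_lifting) E_cong_mult [OF c] mult.assoc mult.left_commute)
  obtain ai where ai: "E (al * ai) = E 1"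
    using al_invertible by blast
  have aim: "E (al ^ m * ai ^ m) = E 1"
    unfolding power_mult_distrib [symmetric]
    by (induction m) (simp_all only: power_0 power_Suc E_cong_mult [OF ai, of _ 1] mult_1)
  have "al ^ m * (e * (1 - c ^ m) * x) = e * x * (al ^ m - al ^ m * c ^ m)"
    by (simp only: left_diff_distrib right_diff_distrib mult_1_left mult_1_right mult_ac)
  also have "E \<dots> = E (e * x * (al ^ m - be ^ m))"
    by (intro E_cong cm refl)
  also have "e * x * (al ^ m - be ^ m) = (e * den m) * (x * x)"
    by (simp only: x_mult_den [symmetric] mult_ac)
  also have "E \<dots> = E (smult 2 (be ^ m) * (x * x))"
    unfolding e_def by (rule E_cong_mult [OF quot_diff_den [OF assms(2)] refl])
  also have "\<dots> = E (smult 2 (al ^ m * c ^ m) * (x * x))"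
    by (intro E_cong cm [symmetric] refl)
  also have "smult 2 (al ^ m * c ^ m) * (x * x) = al ^ m * (smult 2 (c ^ m) * (x * x))"
    by (simp only: mult_smult_left mult_smult_right mult_ac)
  finally have "E (e * (1 - c ^ m) * x) = E (smult 2 (c ^ m) * (x * x))"
    by (rule E_cancel [OF aim])
  then have main: "E (e * (1 - c ^ m) * x * h) = E (smult 2 (c ^ m) * (x * x) * h)"
    by (rule E_cong_mult [OF _ refl])
  \<comment> \<open>Idempotence duplicates \<open>1 - proj\<close>: one copy stays with
    \<open>e\<close>, the other with the decaying power \<open>c ^ m\<close>.\<close>
  have idem: "E ((1 - proj) * (1 - proj)) = E (1 - proj)"
  proof -
    have "(1 - proj) * proj = h * (x * proj)"
      by (simp only: h mult_ac)
    then have "E ((1 - proj) * proj) = 0"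
      by (simp only: mat_poly_mult [of X h] E_x_proj times0_right)
    moreover have "(1 - proj) * (1 - proj) = (1 - proj) - (1 - proj) * proj"
      by (simp only: right_diff_distrib mult_1_right)
    ultimately show ?thesis
      by (simp only: mat_poly_diff [of X "1 - proj"]) simp
  qed
  have "e * (1 - proj) = e * c ^ m * (1 - proj) + e * (1 - c ^ m) * x * h"
    unfolding h by (simp only: left_diff_distrib right_diff_distrib mult_1_left mult_1_right mult_ac) simp
  then have "E (e * (1 - proj)) = E (e * c ^ m * (1 - proj)) + E (smult 2 (c ^ m) * (x * x) * h)"
    by (simp only: mat_poly_add main)
  also have "smult 2 (c ^ m) * (x * x) * h = smult 2 (x * (c ^ m * (1 - proj)))"
    by (simp only: h mult_smult_left mult_smult_right mult_ac)
  also have "E (e * c ^ m * (1 - proj)) = E (e * c ^ m * ((1 - proj) * (1 - proj)))"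
    by (intro E_cong idem [symmetric] refl)
  also have "e * c ^ m * ((1 - proj) * (1 - proj)) = e * (1 - proj) * (c ^ m * (1 - proj))"
    by (simp only: mult_ac)
  finally have "E (e * (1 - proj)) =
      E (e * (1 - proj) * (c ^ m * (1 - proj))) + E (smult 2 (x * (c ^ m * (1 - proj))))" .
  moreover have "E (smult 2 (x * p)) = mat 2 ** X ** E p" for p
    by (simp only: mat_poly_smult mat_poly_mult [of X x] E_x matrix_mul_assoc)
  ultimately show ?thesis
    by (simp only: e_def mat_poly_mult [of X "e * (1 - proj)", unfolded e_def])
qed

text \<open>The projected part contributes the limit exactly for every \<open>m > 0\<close>; the
  complement decays geometrically and survives multiplication by \<open>m\<close>.\<close>

lemma scaled_error_limit: "(\<lambda>m. real m *\<^sub>R (Q m - X)) \<longlonglongrightarrow> \<gamma> *\<^sub>R E proj"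
proof -
  obtain ai where ai: "E (al * ai) = E 1"
    using al_invertible by blast
  define c where "c = ai * be"
  have c: "E (al * c) = E be"
    using E_cong_mult [OF ai refl, of be] by (simp only: c_def mult.assoc mult_1)
  have "E (root_poly L * (1 - proj)) = 0"
  proof -
    obtain h where h: "1 - proj = x * h"
      using poly_eq_0_iff_dvd [of "1 - proj" 0] poly_proj_0 by (auto elim: dvdE)
    have "root_poly L * (1 - proj) = h * (x * root_poly L)"
      by (simp only: h mult_ac)
    then show ?thesis
      by (simp only: mat_poly_mult [of X h] E_root_0 times0_right)
  qed
  then obtain K \<rho> where \<rho>: "0 \<le> \<rho>" "\<rho> < 1"
    and D: "\<And>k. norm (E (c ^ k * (1 - proj))) \<le> K * \<rho> ^ k"
    using cayley_decay [OF c, of L "1 - proj"] roots_pos by blast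
  obtain B where B: "B > 0" "\<And>(A :: complex^'n^'n) (A' :: complex^'n^'n). norm (A ** A') \<le> norm A * norm A' * B"
    using matrix_mult_norm_bound by blast
  define F where "F m = E ((quot m - x) * (1 - proj))" for m
  have \<rho>lim: "(\<lambda>m. \<rho> ^ m) \<longlonglongrightarrow> 0"
    using \<rho> by (intro LIMSEQ_realpow_zero)
  \<comment> \<open>Once this is below \<open>1 / 2\<close>, the term with \<open>F m\<close> on the
    right of the fixed-point equation is absorbed on the left, which turns the constant 2 into
    4.\<close>
  have "(\<lambda>m. K * \<rho> ^ m * B) \<longlonglongrightarrow> K * 0 * B"
    by (intro tendsto_intros \<rho>lim)
  then have ev: "\<forall>\<^sub>F m in sequentially. K * \<rho> ^ m * B < 1 / 2"
    by (rule order_tendstoD) simp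
  have bound: "\<forall>\<^sub>F m in sequentially. norm (real m *\<^sub>R F m) \<le> (4 * norm X * B * K) * (real m * \<rho> ^ m)"
    using ev eventually_gt_at_top [of 0]
  proof eventually_elim
    case (elim m)
    define d where "d = E (c ^ m * (1 - proj))"
    have d: "norm d \<le> K * \<rho> ^ m"
      using D by (simp only: d_def)
    have "F m = F m ** d + mat 2 ** (X ** d)"
      using error_complement [OF c elim(2)] by (simp only: F_def d_def matrix_mul_assoc)
    then have "norm (F m) \<le> norm (F m ** d) + norm (mat 2 ** (X ** d))"
      by (metis norm_triangle_ineq)
    also have "\<dots> \<le> norm (F m) * norm d * B + 2 * (norm X * norm d * B)"
      using B(2) [of "F m" d] B(2) [of X d] by (simp add: norm_mat_mult)
    also have "norm (F m) * norm d * B \<le> norm (F m) * (1 / 2)"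
    proof -
      have "norm d * B \<le> 1 / 2"
        using mult_right_mono [OF d, of B] B(1) elim(1) by linarith
      from mult_left_mono [OF this norm_ge_zero [of "F m"]] show ?thesis
        by (simp only: mult.assoc)
    qed
    finally have "norm (F m) \<le> 4 * (norm X * norm d * B)"
      by simp
    also have "\<dots> \<le> 4 * (norm X * (K * \<rho> ^ m) * B)"
      using d B(1) by (intro mult_left_mono mult_right_mono) simp_all
    finally have "real m * norm (F m) \<le> real m * (4 * (norm X * (K * \<rho> ^ m) * B))"
      by (rule mult_left_mono) simp
    then show ?case
      by (simp add: mult_ac)
  qed
  have "(\<lambda>m. real m * \<rho> ^ m) \<longlonglongrightarrow> 0"
    using powser_times_n_limit_0 [of \<rho>] \<rho> by simp
  then have "(\<lambda>m. (4 * norm X * B * K) * (real m * \<rho> ^ m)) \<longlonglongrightarrow> 0"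
    by (rule tendsto_mult_right_zero)
  then have F0: "(\<lambda>m. real m *\<^sub>R F m) \<longlonglongrightarrow> 0"
    by (rule Lim_null_comparison [OF bound])
  have eq: "real m *\<^sub>R (Q m - X) = \<gamma> *\<^sub>R E proj + real m *\<^sub>R F m" if "m > 0" for m
  proof -
    have "Q m - X = E (quot m - x)"
      by (simp only: Q_def mat_poly_diff E_x)
    also have "quot m - x = (quot m - x) * proj + (quot m - x) * (1 - proj)"
      by (simp only: ring_distribs mult_1_right) simp
    finally have "Q m - X = E ((quot m - x) * proj) + F m"
      by (simp only: mat_poly_add F_def)
    then show ?thesis
      using error_proj [OF that] by (simp only: scaleR_add_right)
  qed
  have "\<forall>\<^sub>F m in sequentially. \<gamma> *\<^sub>R E proj + real m *\<^sub>R F m = real m *\<^sub>R (Q m - X)"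
    by (rule eventually_mono [OF eventually_gt_at_top [of 0]]) (simp only: eq)
  moreover have "(\<lambda>m. \<gamma> *\<^sub>R E proj + real m *\<^sub>R F m) \<longlonglongrightarrow> \<gamma> *\<^sub>R E proj + 0"
    by (intro tendsto_intros F0)
  ultimately show ?thesis
    by (simp only: add_0_right Lim_transform_eventually)
qed

end

section \<open>Rates of convergence\<close>

lemma matrix_norm_0: "matrix_norm N \<Longrightarrow> N 0 = 0"
  by (simp add: matrix_norm_def)

lemma matrix_norm_scaleR:
  assumes "matrix_norm N"
  shows "N (c *\<^sub>R A) = \<bar>c\<bar> * N A"
proof -
  have "c *\<^sub>R A = (\<chi> i j. of_real c * A $ i $ j)"
    by (simp add: vec_eq_iff scaleR_conv_of_real [where 'a = complex])
  then show ?thesis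
    using assms by (simp add: matrix_norm_def)
qed

lemma matrix_norm_sum_le:
  assumes "matrix_norm N" "finite I"
  shows "N (\<Sum>i\<in>I. f i) \<le> (\<Sum>i\<in>I. N (f i))"
  using assms(2)
proof induction
  case empty
  then show ?case
    by (simp add: matrix_norm_0 [OF assms(1)])
next
  case (insert i I)
  have "N (f i + (\<Sum>i\<in>I. f i)) \<le> N (f i) + N (\<Sum>i\<in>I. f i)"
    using assms(1) by (simp add: matrix_norm_def)
  then show ?case
    using insert by simp
qed

text \<open>Expansion in matrix units. A bound in this one direction suffices for the continuity of
  \<open>N\<close>.\<close>

lemma matrix_norm_le_norm:
  fixes N :: "complex^'n^'n \<Rightarrow> real"
  assumes "matrix_norm N"
  shows "\<exists>K. \<forall>A. N A \<le> K * norm A"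
proof -
  define U :: "'n \<Rightarrow> 'n \<Rightarrow> complex^'n^'n" where
    "U i j = (\<chi> k l. if k = i \<and> l = j then 1 else 0)" for i j
  have "N A \<le> (\<Sum>(i, j)\<in>UNIV. N (U i j)) * norm A" for A
  proof -
    define G :: "'n \<times> 'n \<Rightarrow> complex^'n^'n" where
      "G p = (\<chi> k l. A $ fst p $ snd p * U (fst p) (snd p) $ k $ l)" for p
    have "(\<Sum>p\<in>UNIV. G p) $ k $ l = A $ k $ l" for k l
    proof -
      have "(\<Sum>p\<in>UNIV. G p) $ k $ l = (\<Sum>p\<in>UNIV. if p = (k, l) then A $ k $ l else 0)"
        unfolding sum_component by (intro sum.cong) (auto simp: G_def U_def)
      then show ?thesis
        by simp
    qed
    then have "(\<Sum>p\<in>UNIV. G p) = A"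
      unfolding vec_eq_iff by blast
    then have "N A \<le> (\<Sum>p\<in>UNIV. N (G p))"
      using matrix_norm_sum_le [OF assms finite_class.finite_UNIV, of G] by (simp only:)
    also have "\<dots> = (\<Sum>p\<in>UNIV. cmod (A $ fst p $ snd p) * N (U (fst p) (snd p)))"
      using assms by (simp add: matrix_norm_def G_def)
    also have "\<dots> \<le> (\<Sum>p\<in>UNIV. norm A * N (U (fst p) (snd p)))"
    proof (intro sum_mono mult_right_mono)
      show "cmod (A $ fst p $ snd p) \<le> norm A" for p
        by (rule order_trans [OF Finite_Cartesian_Product.norm_nth_le Finite_Cartesian_Product.norm_nth_le])
      show "0 \<le> N (U (fst p) (snd p))" for p
        using assms by (simp add: matrix_norm_def)
    qed
    finally show ?thesis
      by (simp add: sum_distrib_left case_prod_beta mult.commute)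
  qed
  then show ?thesis
    by blast
qed

lemma matrix_norm_tendsto:
  fixes N :: "complex^'n^'n \<Rightarrow> real"
  assumes N: "matrix_norm N" and f: "(f \<longlongrightarrow> A) F"
  shows "((\<lambda>m. N (f m)) \<longlongrightarrow> N A) F"
proof -
  obtain K where K: "\<forall>B. N B \<le> K * norm B"
    using matrix_norm_le_norm [OF N] by (elim exE)
  have tri: "N (B + C) \<le> N B + N C" for B C
    using N by (simp add: matrix_norm_def)
  have "N (A - B) = N (B - A)" for B
    using matrix_norm_scaleR [OF N, of "- 1" "B - A"] by simp
  then have "\<bar>N B - N A\<bar> \<le> K * norm (B - A)" for B
    using tri [of "B - A" A] tri [of "A - B" B] K [rule_format, of "B - A"] by simp
  then have ev: "\<forall>\<^sub>F m in F. norm (N (f m) - N A) \<le> K * norm (f m - A)"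
    by (simp add: always_eventually)
  have "((\<lambda>m. K * norm (f m - A)) \<longlongrightarrow> K * norm (A - A)) F"
    by (intro tendsto_intros f)
  then have "((\<lambda>m. N (f m) - N A) \<longlongrightarrow> 0) F"
    by (intro Lim_null_comparison [OF ev]) simp
  then show ?thesis
    by (simp add: LIM_zero_iff)
qed

text \<open>Since \<open>m * N (Y m - L)\<close> tends to the nonzero \<open>N Z\<close>, the error
  along \<open>s\<close> behaves like \<open>N Z / s k\<close>, and quotients of errors like
  \<open>s k / s (k + 1)\<close>. The shift in \<open>T\<close> skips the dummy value at index
  0.\<close>

lemma subsequence_rate:
  fixes N :: "complex^'n^'n \<Rightarrow> real"
  assumes N: "matrix_norm N"
    and Y: "(\<lambda>m. real m *\<^sub>R (Y m - L)) \<longlonglongrightarrow> Z" "Z \<noteq> 0"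
    and s: "filterlim s at_top sequentially" "\<And>k. s k > 0"
    and ratio: "(\<lambda>k. real (s k) / real (s (Suc k))) \<longlonglongrightarrow> \<sigma>"
    and T: "\<And>k. T (Suc k) = Y (s k)"
  shows "T \<longlonglongrightarrow> L" "(\<lambda>k. N (T (Suc k) - L) / N (T k - L)) \<longlonglongrightarrow> \<sigma>"
proof -
  have "(\<lambda>m. (1 / real m) *\<^sub>R (real m *\<^sub>R (Y m - L))) \<longlonglongrightarrow> 0 *\<^sub>R Z"
    by (intro tendsto_scaleR Y(1) lim_1_over_n)
  moreover have "\<forall>\<^sub>F m in sequentially. (1 / real m) *\<^sub>R (real m *\<^sub>R (Y m - L)) = Y m - L"
    using eventually_gt_at_top [of 0] by eventually_elim simp
  ultimately have "(\<lambda>m. Y m - L) \<longlonglongrightarrow> 0"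
    using tendsto_cong by fastforce
  then have "Y \<longlonglongrightarrow> L"
    by (simp add: LIM_zero_iff)
  then have "(\<lambda>k. Y (s k)) \<longlonglongrightarrow> L"
    using s(1) by (rule filterlim_compose)
  then have "(\<lambda>k. T (Suc k)) \<longlonglongrightarrow> L"
    by (simp only: T)
  then show "T \<longlonglongrightarrow> L"
    by (rule LIMSEQ_imp_Suc)
  define u where "u m = N (real m *\<^sub>R (Y m - L))" for m
  have u_eq: "u m = real m * N (Y m - L)" for m
    by (simp add: u_def matrix_norm_scaleR [OF N])
  have "u \<longlonglongrightarrow> N Z"
    unfolding u_def by (rule matrix_norm_tendsto [OF N Y(1)])
  then have us: "(\<lambda>k. u (s k)) \<longlonglongrightarrow> N Z"
    using s(1) by (rule filterlim_compose)
  have "N Z \<noteq> 0"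
    using N Y(2) by (simp add: matrix_norm_def)
  then have "(\<lambda>k. u (s (Suc k)) / u (s k) * (real (s k) / real (s (Suc k)))) \<longlonglongrightarrow> N Z / N Z * \<sigma>"
    by (intro tendsto_intros us LIMSEQ_Suc [OF us] ratio)
  moreover have "u (s (Suc k)) / u (s k) * (real (s k) / real (s (Suc k))) =
      N (T (Suc (Suc k)) - L) / N (T (Suc k) - L)" for k
    using s(2) [of k] s(2) [of "Suc k"] by (simp add: u_eq T)
  ultimately have "(\<lambda>k. N (T (Suc (Suc k)) - L) / N (T (Suc k) - L)) \<longlonglongrightarrow> \<sigma>"
    using \<open>N Z \<noteq> 0\<close> by simp
  then show "(\<lambda>k. N (T (Suc k) - L) / N (T k - L)) \<longlonglongrightarrow> \<sigma>"
    by (rule LIMSEQ_imp_Suc)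
qed

theorem corollary4p1:
  fixes S :: "complex^'n^'n" and \<gamma> :: real and r :: nat
    and N :: "complex^'n^'n \<Rightarrow> real"
  assumes "\<not> invertible S"
    and "eigenvalues S \<subseteq> right_half_plane \<union> {0}"
    and "semisimple_eigenvalue S 0"
    and "\<gamma> > 0" and "r > 1"
    and "matrix_norm N"
  shows "converges_sublinearly N (basic_iter \<gamma> S) (matrix_sqrt S) \<and>
         converges_q_linearly N (1 / real r) (order_iter r \<gamma> S) (matrix_sqrt S)"
proof -
  define X where "X = matrix_sqrt S"
  have XX: "X ** X = S"
    unfolding X_def by (rule matrix_sqrt_square [OF assms(2,3)])
  have X: "eigenvalues X \<subseteq> right_half_plane \<union> {0}" "semisimple_eigenvalue X 0"
    unfolding X_def
    by (rule eigenvalues_matrix_sqrt [OF assms(2,3)], rule semisimple_matrix_sqrt [OF assms(2,3)])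
  obtain L where L: "set L \<subseteq> eigenvalues X - {0}" "mat_poly X ([:0, 1:] * root_poly L) = 0"
    using annihilating_list_semisimple [OF X(2)] .
  interpret singular_root X L \<gamma>
  proof
    show "mat_poly X (root_poly (0 # L)) = 0"
      using L(2) by (simp only: list.map prod_list.Cons minus_zero)
    show "Re c > 0" if "c \<in> set L" for c
      using that L(1) X(1) by (auto simp: right_half_plane_def)
    show "\<not> invertible X"
      using X(2) unfolding semisimple_0_iff by blast
  qed (rule assms(4))
  have nz: "\<gamma> *\<^sub>R E proj \<noteq> 0"
    using gamma_pos proj_nonzero by simp
  \<comment> \<open>One limit serves both claims: the indices \<open>Suc k\<close> have quotients
    tending to 1, the indices \<open>r ^ k\<close> have constant quotient
    \<open>1 / r\<close>.\<close>
  note rate = subsequence_rate [OF assms(6) scaled_error_limit nz]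
  have "filterlim Suc at_top sequentially"
    by (rule filterlim_Suc)
  moreover have "(\<lambda>k. real (Suc k) / real (Suc (Suc k))) \<longlonglongrightarrow> 1"
    using LIMSEQ_Suc [OF LIMSEQ_n_over_Suc_n] by simp
  moreover have "filterlim (\<lambda>k. r ^ k) at_top sequentially"
    using assms(5) by (intro filterlim_subseq) (simp add: strict_mono_def)
  moreover have "(\<lambda>k. real (r ^ k) / real (r ^ Suc k)) \<longlonglongrightarrow> 1 / real r"
    using assms(5) by simp
  ultimately have basic: "basic_iter \<gamma> S \<longlonglongrightarrow> X \<and>
      (\<lambda>k. N (basic_iter \<gamma> S (Suc k) - X) / N (basic_iter \<gamma> S k - X)) \<longlonglongrightarrow> 1"
    and order: "order_iter r \<gamma> S \<longlonglongrightarrow> X \<and>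
      (\<lambda>k. N (order_iter r \<gamma> S (Suc k) - X) / N (order_iter r \<gamma> S k - X)) \<longlonglongrightarrow> 1 / real r"
    using rate [of Suc 1 "basic_iter \<gamma> S"] basic_iter_eq [unfolded XX]
      rate [of "\<lambda>k. r ^ k" "1 / real r" "order_iter r \<gamma> S"] order_iter_eq [OF assms(5), unfolded XX]
      assms(5)
    by simp_all
  from basic order show ?thesis
    using assms(5) by (simp add: converges_sublinearly_def converges_q_linearly_def X_def)
qed

end
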